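(* Let $c\in(0,1)$. For every $a\in[1/4,1/3]$, the tree $T_a$ admits a bi-Lipschitz embedding into $\mathbb R^2$. Moreover, $$\dim_H(T_a)=\dim_N(T_a)=\dim_{\mathrm A}(T_a)=1.$$
   Context: Construction of $T_a$ (depending also on the fixed $c\in(0,1)$): start with a line segment $I_0$ of length $1$, and attach at each of its two endpoints two line segments of length $c$; the result is $T_0^a$, and $I_0$ is its distinguished interval. Inductively, at each stage, every current distinguished interval $I$ is subdivided into three consecutive intervals of lengths $a|I|$, $(1-2a)|I|$, $a|I|$, and one new line segment of length $ca|I|$ is attached (by one of its endpoints) at each of the two interior subdivision points of $I$; the three subintervals become distinguished intervals for the next stage. The attached segments are never subdivided. This yields increasing sets $T_0^a\subset T_1^a\subset\cdots$, and $T_a=\bigcup_{k\ge0}T_k^a$ with the induced path metric (so distances are lengths of the unique connecting paths). A map $f:X\to Y$ is a bi-Lipschitz embedding if there are constants $k,K>0$ with $\frac1k d(x,y)\le d(f(x),f(y))\le K d(x,y)$ for all $x,y\in X$; $\mathbb R^2$ carries the Euclidean metric. $\dim_H$ is Hausdorff dimension. $\dim_N X$ (Nagata dimension) is the least integer $m\ge0$ for which there is a constant $\kappa>0$ such that for every $s>0$, $X$ has a cover by sets of diameter at most $\kappa s$ such that every subset of $X$ of diameter at most $s$ meets at most $m+1$ members of the cover. $\dim_{\mathrm A}X$ (Assouad dimension) is the infimum of all $s\ge0$ for which there exists $C\ge1$ such that every ball $B_X(x,R)$ can be covered by at most $C(R/r)^s$ balls of radius $r$, for every $x\in X$ and $0<r<R$.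 *)

theory Defs
  imports "HOL-Analysis.Analysis"
begin

section \<open>The trees\<close>

text \<open>
  A distinguished interval \<open>{l..l + w}\<close> of the axis is represented by its left endpoint and its
  length, as the pair \<open>(l, w)\<close>.
\<close>

primrec distinguished :: "real \<Rightarrow> nat \<Rightarrow> (real \<times> real) set" where
  "distinguished a 0 = {(0, 1)}"
| "distinguished a (Suc k) =
     (\<Union>(l, w) \<in> distinguished a k.
        {(l, a * w), (l + a * w, (1 - 2 * a) * w), (l + (1 - a) * w, a * w)})"

text \<open>
  The underlying set is drawn in the plane: \<open>I\<^sub>0\<close> is the unit interval of the horizontal axis and
  all attached segments are vertical, with the two segments at an endpoint of \<open>I\<^sub>0\<close> pointing
  in opposite directions. For \<open>0 < a < 1/2\<close> all subdivision points are pairwise distinct, so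
  the segments meet only where they are attached and no identifications beyond the prescribed
  ones occur. The plane only serves to name the points and to measure the lengths of the
  segments; the metric of the tree is \<open>tree_dist\<close> below, not the Euclidean one.
\<close>

primrec tree_stage :: "real \<Rightarrow> real \<Rightarrow> nat \<Rightarrow> (real \<times> real) set" where
  "tree_stage c a 0 =
     closed_segment (0, 0) (1, 0) \<union>
     closed_segment (0, 0) (0, c) \<union> closed_segment (0, 0) (0, - c) \<union>
     closed_segment (1, 0) (1, c) \<union> closed_segment (1, 0) (1, - c)"
| "tree_stage c a (Suc k) =
     tree_stage c a k \<union>
     (\<Union>(l, w) \<in> distinguished a k.
        closed_segment (l + a * w, 0) (l + a * w, c * a * w) \<union>
        closed_segment (l + (1 - a) * w, 0) (l + (1 - a) * w, c * a * w))"

definition tree :: "real \<Rightarrow> real \<Rightarrow> (real \<times> real) set" where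
  "tree c a = (\<Union>k. tree_stage c a k)"

definition path_length :: "(real \<Rightarrow> 'a::metric_space) \<Rightarrow> ennreal" where
  "path_length g =
     (SUP (n, t) \<in> {(n, t :: nat \<Rightarrow> real). mono_on {..n} t \<and> t ` {..n} \<subseteq> {0..1}}.
        ennreal (\<Sum>i<n. dist (g (t i)) (g (t (Suc i)))))"

definition path_dist :: "'a::metric_space set \<Rightarrow> 'a \<Rightarrow> 'a \<Rightarrow> real" where
  "path_dist S p q =
     enn2real (INF g \<in> {g. path g \<and> path_image g \<subseteq> S \<and> pathstart g = p \<and> pathfinish g = q}.
       path_length g)"

definition tree_dist :: "real \<Rightarrow> real \<Rightarrow> real \<times> real \<Rightarrow> real \<times> real \<Rightarrow> real" where
  "tree_dist c a = path_dist (tree c a)"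


section \<open>Embeddings and dimensions of a metric space \<open>(X, d)\<close>\<close>

definition bilipschitz_embedding ::
    "'a set \<Rightarrow> ('a \<Rightarrow> 'a \<Rightarrow> real) \<Rightarrow> ('a \<Rightarrow> 'b::metric_space) \<Rightarrow> bool" where
  "bilipschitz_embedding X d f \<longleftrightarrow>
     (\<exists>k>0. \<exists>K>0. \<forall>x\<in>X. \<forall>y\<in>X. 1 / k * d x y \<le> dist (f x) (f y) \<and> dist (f x) (f y) \<le> K * d x y)"

definition ediam :: "('a \<Rightarrow> 'a \<Rightarrow> real) \<Rightarrow> 'a set \<Rightarrow> ennreal" where
  "ediam d U = (SUP x\<in>U. SUP y\<in>U. ennreal (d x y))"

text \<open>
  The summand \<open>(diam U)\<^sup>s\<close>, with the conventions \<open>0\<^sup>0 = 1\<close> for nonempty \<open>U\<close> and value \<open>0\<close>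
  for the empty set (in the library, \<open>0 powr 0 = 0\<close>). It is only used for sets of
  finite diameter.
\<close>

definition diam_powr :: "('a \<Rightarrow> 'a \<Rightarrow> real) \<Rightarrow> real \<Rightarrow> 'a set \<Rightarrow> ennreal" where
  "diam_powr d s U =
     (if U = {} then 0 else if s = 0 then 1 else ennreal (enn2real (ediam d U) powr s))"

definition hausdorff_premeasure ::
    "'a set \<Rightarrow> ('a \<Rightarrow> 'a \<Rightarrow> real) \<Rightarrow> real \<Rightarrow> real \<Rightarrow> ennreal" where
  "hausdorff_premeasure X d s \<delta> =
     (INF U \<in> {U :: nat \<Rightarrow> 'a set. X \<subseteq> (\<Union>i. U i) \<and> (\<forall>i. U i \<subseteq> X \<and> ediam d (U i) \<le> ennreal \<delta>)}.
        \<Sum>i. diam_powr d s (U i))"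

definition hausdorff_measure :: "'a set \<Rightarrow> ('a \<Rightarrow> 'a \<Rightarrow> real) \<Rightarrow> real \<Rightarrow> ennreal" where
  "hausdorff_measure X d s = (SUP \<delta>\<in>{0<..}. hausdorff_premeasure X d s \<delta>)"

definition hausdorff_dim :: "'a set \<Rightarrow> ('a \<Rightarrow> 'a \<Rightarrow> real) \<Rightarrow> ennreal" where
  "hausdorff_dim X d = Inf {ennreal s | s. 0 \<le> s \<and> hausdorff_measure X d s = 0}"

text \<open>The Nagata dimension is \<open>\<infinity>\<close> if no suitable integer exists.\<close>

definition nagata_dim :: "'a set \<Rightarrow> ('a \<Rightarrow> 'a \<Rightarrow> real) \<Rightarrow> enat" where
  "nagata_dim X d =
     Inf {enat m | m. \<exists>\<kappa>>0. \<forall>s>0. \<exists>\<B>.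
       \<Union>\<B> = X \<and> (\<forall>B\<in>\<B>. ediam d B \<le> ennreal (\<kappa> * s)) \<and>
       (\<forall>A\<subseteq>X. ediam d A \<le> ennreal s \<longrightarrow>
          finite {B\<in>\<B>. A \<inter> B \<noteq> {}} \<and> card {B\<in>\<B>. A \<inter> B \<noteq> {}} \<le> m + 1)}"

text \<open>Balls are open and have their centres in \<open>X\<close>.\<close>

definition assouad_dim :: "'a set \<Rightarrow> ('a \<Rightarrow> 'a \<Rightarrow> real) \<Rightarrow> ennreal" where
  "assouad_dim X d =
     Inf {ennreal s | s. 0 \<le> s \<and> (\<exists>C\<ge>1. \<forall>x\<in>X. \<forall>r R. 0 < r \<and> r < R \<longrightarrow>
       (\<exists>F\<subseteq>X. finite F \<and> real (card F) \<le> C * (R / r) powr s \<and>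
          Metric_space.mball X d x R \<subseteq> (\<Union>y\<in>F. Metric_space.mball X d y r)))}"

end

theory Submission
  imports Defs
begin

text \<open>
  Drawn in the plane, the tree is a comb: a horizontal base \<open>[0,1]\<close> with vertical teeth. The
  proof rests on one inequality, the gap condition of the locale \<open>comb\<close>: two points \<open>(x, h)\<close>
  and \<open>(x', h')\<close> over different points of the base satisfy \<open>min \<bar>h\<bar> \<bar>h'\<bar> \<le> \<bar>x - x'\<bar>\<close>. It holds
  because a tooth attached inside an interval of length \<open>w\<close> has length \<open>c a w \<le> a w\<close>, and its foot has
  distance at least \<open>min (a w) ((1 - 2a) w) = a w\<close> from all subdivision points that are already
  there or created at the same stage (\<open>tree_is_comb\<close>).

  The gap condition forces paths to leave a tooth through its foot, so that the path metric is
  the expected one, \<open>\<bar>h\<bar> + \<bar>x - x'\<bar> + \<bar>h'\<bar>\<close> between different teeth (\<open>path_dist_eq_comb_dist\<close>).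
  It also bounds the smaller of the two heights by the horizontal distance, and therefore the
  path metric by four times the Euclidean metric: the drawing itself is the bi-Lipschitz
  embedding (\<open>bilipschitz_in_plane\<close>).

  The Nagata dimension is at least \<open>1\<close> because the comb contains an interval, and at most \<open>1\<close> by
  an explicit cover by pieces of the base, with the lower parts of the teeth on them, and pieces
  of the upper parts of the teeth (\<open>nagata_cover\<close>). For the other two dimensions,
  \<open>1 \<le> dim\<^sub>H \<le> dim\<^sub>A \<le> 1\<close>. The first inequality comes from the projection to the base, the second one
  holds in every bounded space, and the third one is a count of teeth: by the gap condition, a ball
  of radius \<open>R\<close> contains \<open>O(1 + R/\<lambda>)\<close> teeth of height at least \<open>\<lambda>\<close>, and the sum over
  \<open>\<lambda> = r, 2r, 3r, \<dots>\<close> gives a cover by \<open>O((R/r) (1 + ln (R/r)))\<close> balls of radius \<open>r\<close> (\<open>small_cover_ball\<close>).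
\<close>

section \<open>Lengths of paths\<close>

text \<open>
  The function \<open>\<phi>\<close> is a substitute for arc length from the start of the path: a bound of this kind
  adds up under concatenation, whereas the supremum over partitions would first have to be refined
  at the junction.
\<close>

definition length_bounded :: "(real \<Rightarrow> 'a::metric_space) \<Rightarrow> real \<Rightarrow> bool" where
  "length_bounded g L \<longleftrightarrow>
     (\<exists>\<phi>. \<phi> 0 = 0 \<and> \<phi> 1 = L \<and> (\<forall>s t. 0 \<le> s \<longrightarrow> s \<le> t \<longrightarrow> t \<le> 1 \<longrightarrow> dist (g s) (g t) \<le> \<phi> t - \<phi> s))"

lemma path_length_le_length_bounded:
  assumes "length_bounded g L"
  shows "path_length g \<le> ennreal L"
proof -
  from assms obtain \<phi> where \<phi>: "\<phi> 0 = 0" "\<phi> 1 = L"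
    and d: "\<And>s t. 0 \<le> s \<Longrightarrow> s \<le> t \<Longrightarrow> t \<le> 1 \<Longrightarrow> dist (g s) (g t) \<le> \<phi> t - \<phi> s"
    unfolding length_bounded_def by blast
  have mono: "\<phi> s \<le> \<phi> t" if "0 \<le> s" "s \<le> t" "t \<le> 1" for s t
    using d[OF that] zero_le_dist[of "g s" "g t"] by linarith
  have "(\<Sum>i<n. dist (g (t i)) (g (t (Suc i)))) \<le> L"
    if t: "mono_on {..n} t" "t ` {..n} \<subseteq> {0..1}" for n and t :: "nat \<Rightarrow> real"
  proof -
    have r: "0 \<le> t i" "t i \<le> 1" if "i \<le> n" for i using t(2) that by auto
    have "(\<Sum>i<n. dist (g (t i)) (g (t (Suc i)))) \<le> (\<Sum>i<n. \<phi> (t (Suc i)) - \<phi> (t i))"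
      by (intro sum_mono d) (use r t(1) in \<open>auto simp: mono_on_def\<close>)
    also have "\<dots> = \<phi> (t n) - \<phi> (t 0)" by (rule sum_lessThan_telescope)
    also have "\<dots> \<le> L" using mono[of "t n" 1] mono[of 0 "t 0"] r[of n] r[of 0] \<phi> by simp
    finally show ?thesis .
  qed
  then show ?thesis
    unfolding path_length_def by (auto intro!: SUP_least ennreal_leI)
qed

lemma length_bounded_linepath: "length_bounded (linepath p q) (dist p q)"
  for p q :: "'a::real_normed_vector"
  unfolding length_bounded_def
proof (intro exI[of _ "\<lambda>t. t * dist p q"] conjI allI impI)
  fix s t :: real assume "0 \<le> s" "s \<le> t" "t \<le> 1"
  have "linepath p q s - linepath p q t = (t - s) *\<^sub>R (p - q)"
    by (simp add: linepath_def algebra_simps)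
  then have "dist (linepath p q s) (linepath p q t) = (t - s) * dist p q"
    unfolding dist_norm using \<open>s \<le> t\<close> by simp
  then show "dist (linepath p q s) (linepath p q t) \<le> t * dist p q - s * dist p q"
    by (simp add: left_diff_distrib)
qed auto

lemma length_bounded_join:
  assumes "length_bounded g L" "length_bounded h M" "pathfinish g = pathstart h"
  shows "length_bounded (g +++ h) (L + M)"
proof -
  from assms(1) obtain \<phi> where \<phi>: "\<phi> 0 = 0" "\<phi> 1 = L"
    and d\<phi>: "\<And>s t. 0 \<le> s \<Longrightarrow> s \<le> t \<Longrightarrow> t \<le> 1 \<Longrightarrow> dist (g s) (g t) \<le> \<phi> t - \<phi> s"
    unfolding length_bounded_def by blast
  from assms(2) obtain \<psi> where \<psi>: "\<psi> 0 = 0" "\<psi> 1 = M"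
    and d\<psi>: "\<And>s t. 0 \<le> s \<Longrightarrow> s \<le> t \<Longrightarrow> t \<le> 1 \<Longrightarrow> dist (h s) (h t) \<le> \<psi> t - \<psi> s"
    unfolding length_bounded_def by blast
  show ?thesis
    unfolding length_bounded_def
  proof (intro exI[of _ "\<lambda>t. if t \<le> 1/2 then \<phi> (2 * t) else L + \<psi> (2 * t - 1)"] conjI allI impI)
    fix s t :: real assume st: "0 \<le> s" "s \<le> t" "t \<le> 1"
    consider "t \<le> 1/2" | "s > 1/2" | "s \<le> 1/2" "t > 1/2" by linarith
    then show "dist ((g +++ h) s) ((g +++ h) t) \<le>
       (if t \<le> 1/2 then \<phi> (2 * t) else L + \<psi> (2 * t - 1)) -
       (if s \<le> 1/2 then \<phi> (2 * s) else L + \<psi> (2 * s - 1))"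
    proof cases
      case 1 then show ?thesis using st d\<phi>[of "2 * s" "2 * t"] by (simp add: joinpaths_def)
    next
      case 2 then show ?thesis using st d\<psi>[of "2 * s-1" "2 * t-1"] by (simp add: joinpaths_def)
    next
      case 3
      have "dist (g (2 * s)) (h (2 * t-1)) \<le> dist (g (2 * s)) (g 1) + dist (h 0) (h (2 * t-1))"
        using assms(3) by (metis dist_triangle pathfinish_def pathstart_def)
      also have "\<dots> \<le> (\<phi> 1 - \<phi> (2 * s)) + (\<psi> (2 * t-1) - \<psi> 0)"
        using 3 st by (intro add_mono d\<phi> d\<psi>) auto
      finally show ?thesis using 3 \<phi> \<psi> by (simp add: joinpaths_def)
    qed
  qed (use \<phi> \<psi> in auto)
qed

text \<open>
  For lower bounds on the length of a path in a comb it suffices to look at the two endpoints and at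
  the first and the last time at which the path is on the base.
\<close>

lemma path_length_ge_three:
  assumes "0 \<le> S" "S \<le> T" "T \<le> 1"
  shows "ennreal (dist (g 0) (g S) + dist (g S) (g T) + dist (g T) (g 1)) \<le> path_length g"
proof -
  define t :: "nat \<Rightarrow> real" where
    "t i = (if i = 0 then 0 else if i = 1 then S else if i = 2 then T else 1)" for i
  have "mono_on {..3} t" "t ` {..3} \<subseteq> {0..1}"
    using assms by (auto simp: mono_on_def t_def)
  moreover have "(\<Sum>i<3. dist (g (t i)) (g (t (Suc i)))) =
      dist (g 0) (g S) + dist (g S) (g T) + dist (g T) (g 1)"
    by (simp add: t_def eval_nat_numeral)
  ultimately show ?thesis
    unfolding path_length_def
    by (intro SUP_upper2[of "(3, t)"]) auto
qed

text \<open>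
  The infimum over the empty set of paths is \<open>\<infinity>\<close>, which the real-valued distance turns into \<open>0\<close>.
  This makes the distance symmetric on the whole plane, as the theory of metric spaces requires.
\<close>

lemma path_dist_outside:
  assumes "p \<notin> S \<or> q \<notin> S"
  shows "path_dist S p q = 0"
proof -
  have none: "{g. path g \<and> path_image g \<subseteq> S \<and> pathstart g = p \<and> pathfinish g = q} = {}"
    using assms pathstart_in_path_image pathfinish_in_path_image by blast
  show ?thesis unfolding path_dist_def none by simp
qed

section \<open>Comparing the dimensions of a metric space\<close>

lemma ediam_le_iff:
  assumes "0 \<le> s"
  shows "ediam d U \<le> ennreal s \<longleftrightarrow> (\<forall>x\<in>U. \<forall>y\<in>U. d x y \<le> s)"
  using assms by (simp add: ediam_def SUP_le_iff ennreal_le_iff)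

text \<open>
  If \<open>s < 1\<close> and the \<open>s\<close>-dimensional measure vanishes, there is a cover by sets of diameters
  \<open>\<delta>\<^sub>i \<le> 1\<close> with \<open>\<Sum>\<delta>\<^sub>i\<^sup>s < 1\<close>. Then \<open>\<Sum>\<delta>\<^sub>i \<le> \<Sum>\<delta>\<^sub>i\<^sup>s < 1\<close>, while the images under \<open>\<pi>\<close> lie in
  intervals of lengths \<open>\<delta>\<^sub>i\<close> that cover an interval of Lebesgue measure \<open>1\<close>.
\<close>

lemma hausdorff_dim_ge_1:
  fixes \<pi> :: "'a \<Rightarrow> real"
  assumes lip: "\<And>p q. p \<in> X \<Longrightarrow> q \<in> X \<Longrightarrow> \<bar>\<pi> p - \<pi> q\<bar> \<le> d p q" and onto: "{0..1} \<subseteq> \<pi> ` X"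
  shows "1 \<le> hausdorff_dim X d"
  unfolding hausdorff_dim_def
proof (rule Inf_greatest, clarify)
  fix s :: real assume "0 \<le> s" and null: "hausdorff_measure X d s = 0"
  show "1 \<le> ennreal s"
  proof (rule ccontr)
    assume "\<not> 1 \<le> ennreal s"
    then have "s < 1" using ennreal_leI[of 1 s] by fastforce
    have "hausdorff_premeasure X d s 1 \<le> hausdorff_measure X d s"
      unfolding hausdorff_measure_def by (rule SUP_upper) simp
    then have "hausdorff_premeasure X d s 1 < 1" using null by simp
    then obtain U :: "nat \<Rightarrow> 'a set" where X: "X \<subseteq> (\<Union>i. U i)"
      and U: "\<And>i. U i \<subseteq> X" "\<And>i. ediam d (U i) \<le> ennreal 1"
      and small: "(\<Sum>i. diam_powr d s (U i)) < 1"
      unfolding hausdorff_premeasure_def INF_less_iff by blast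
    define \<delta> where "\<delta> i = enn2real (ediam d (U i))" for i
    have ed: "ediam d (U i) = ennreal (\<delta> i)" for i
      unfolding \<delta>_def using le_less_trans[OF U(2)[of i] ennreal_less_top] by simp
    have \<delta>: "0 \<le> \<delta> i" "\<delta> i \<le> 1" for i
    proof -
      show "0 \<le> \<delta> i" unfolding \<delta>_def by simp
      have "ennreal (\<delta> i) \<le> ennreal 1" using U(2)[of i] unfolding ed .
      then show "\<delta> i \<le> 1" by (subst (asm) ennreal_le_iff) simp_all
    qed
    have diam: "d p q \<le> \<delta> i" if "p \<in> U i" "q \<in> U i" for p q i
      using ediam_le_iff[OF \<delta>(1), of d "U i" i] ed that by simp
    define J where "J i = (if U i = {} then {} else {Inf (\<pi> ` U i)..Inf (\<pi> ` U i) + \<delta> i})" for i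
    have sub: "\<pi> ` U i \<subseteq> J i" for i
    proof (cases "U i = {}")
      case False
      then obtain u where u: "u \<in> U i" by blast
      have close: "\<pi> q - \<delta> i \<le> \<pi> p" if "p \<in> U i" "q \<in> U i" for p q
      proof -
        have "\<bar>\<pi> p - \<pi> q\<bar> \<le> d p q" using lip U(1)[of i] that by blast
        then show ?thesis using diam[OF that] by linarith
      qed
      have "bdd_below (\<pi> ` U i)" by (rule bdd_belowI2[of _ "\<pi> u - \<delta> i"]) (rule close[OF _ u])
      then have "Inf (\<pi> ` U i) \<le> \<pi> q" if "q \<in> U i" for q using that by (simp add: cInf_lower)
      moreover have "\<pi> q - \<delta> i \<le> Inf (\<pi> ` U i)" if "q \<in> U i" for q
        using False close that by (intro cINF_greatest) auto
      ultimately show ?thesis using False by (auto simp: J_def algebra_simps)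
    qed simp
    have "{0..1} \<subseteq> (\<Union>i. J i)"
    proof
      fix x :: real assume "x \<in> {0..1}"
      then obtain p where "p \<in> X" "x = \<pi> p" using onto by blast
      moreover then obtain i where "p \<in> U i" using X by blast
      ultimately show "x \<in> (\<Union>i. J i)" using sub[of i] by blast
    qed
    then have "emeasure lborel {0..1::real} \<le> emeasure lborel (\<Union>i. J i)"
      by (intro emeasure_mono) (auto simp: J_def)
    also have "\<dots> \<le> (\<Sum>i. emeasure lborel (J i))"
      by (rule emeasure_subadditive_countably) (auto simp: J_def)
    also have "\<dots> \<le> (\<Sum>i. diam_powr d s (U i))"
    proof (rule suminf_le)
      fix i
      show "emeasure lborel (J i) \<le> diam_powr d s (U i)"
      proof (cases "U i = {} \<or> s = 0")
        case True
        then show ?thesis using \<delta>[of i] by (auto simp: J_def diam_powr_def intro: ennreal_leI[of _ 1, simplified])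
      next
        case False
        have "\<delta> i powr 1 \<le> \<delta> i powr s"
          using \<delta>[of i] \<open>s < 1\<close> by (intro powr_mono') simp_all
        then show ?thesis
          using False \<delta>[of i] by (auto simp: J_def diam_powr_def \<delta>_def[symmetric] intro: ennreal_leI)
      qed
    qed auto
    also have "\<dots> < 1" by (rule small)
    finally show False by simp
  qed
qed

text \<open>
  The balls of radius \<open>r\<close> of a cover contribute at most \<open>C (R/r)\<^sup>t (2r)\<^sup>s\<close>, a multiple of
  \<open>r\<^sup>s\<^sup>-\<^sup>t\<close>, which tends to \<open>0\<close> with \<open>r\<close>.
\<close>

lemma hausdorff_measure_eq_0:
  assumes M: "Metric_space X d" and "0 \<le> t" "t < s" "0 < R"
    and cover: "\<And>r. 0 < r \<Longrightarrow> r < R \<Longrightarrow> \<exists>F\<subseteq>X. finite F \<and> real (card F) \<le> C * (R / r) powr t \<and>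
      X \<subseteq> (\<Union>y\<in>F. Metric_space.mball X d y r)"
  shows "hausdorff_measure X d s = 0"
proof -
  interpret Metric_space X d by (rule M)
  have bound: "hausdorff_premeasure X d s \<delta> \<le> ennreal (C * (R / r) powr t * (2 * r) powr s)"
    if r: "0 < r" "r < R" "2 * r \<le> \<delta>" for \<delta> r
  proof -
    obtain F where F: "F \<subseteq> X" "finite F" "real (card F) \<le> C * (R / r) powr t" "X \<subseteq> (\<Union>y\<in>F. mball y r)"
      using cover[OF r(1,2)] by blast
    obtain f where f: "bij_betw f {..<card F} F"
      using ex_bij_betw_nat_finite[OF F(2)] by (auto simp: lessThan_atLeast0)
    define U where "U i = (if i < card F then mball (f i) r else {})" for i
    have dU: "d p q \<le> 2 * r" if "p \<in> U i" "q \<in> U i" for p q i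
      using that triangle''[of p "f i" q] by (auto simp: U_def commute split: if_splits)
    have ed: "ediam d (U i) \<le> ennreal (2 * r)" for i
      using dU r by (simp add: ediam_le_iff)
    have "hausdorff_premeasure X d s \<delta> \<le> (\<Sum>i. diam_powr d s (U i))"
      unfolding hausdorff_premeasure_def
    proof (rule INF_lower, clarify, intro conjI allI)
      show "X \<subseteq> (\<Union>i. U i)"
      proof
        fix p assume "p \<in> X"
        then obtain y where y: "y \<in> F" "p \<in> mball y r" using F(4) by blast
        then obtain i where "i < card F" "y = f i" using bij_betw_imp_surj_on[OF f] by blast
        then show "p \<in> (\<Union>i. U i)" using y by (intro UN_I[of i]) (simp_all add: U_def)
      qed
      show "U i \<subseteq> X" for i by (auto simp: U_def)
      show "ediam d (U i) \<le> ennreal \<delta>" for i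
        using ed[of i] ennreal_leI[OF r(3)] by (rule order_trans)
    qed
    also have "\<dots> = (\<Sum>i<card F. diam_powr d s (U i))"
      by (rule suminf_finite) (auto simp: U_def diam_powr_def)
    also have "\<dots> \<le> (\<Sum>i<card F. ennreal ((2 * r) powr s))"
    proof (rule sum_mono)
      fix i
      have "enn2real (ediam d (U i)) \<le> 2 * r" using ed[of i] r by (simp add: enn2real_leI)
      then show "diam_powr d s (U i) \<le> ennreal ((2 * r) powr s)"
        using assms(2,3) by (auto simp: diam_powr_def intro!: ennreal_leI powr_mono2)
    qed
    also have "\<dots> = ennreal (card F * (2 * r) powr s)"
      by (simp add: ennreal_mult' ennreal_of_nat_eq_real_of_nat)
    also have "\<dots> \<le> ennreal (C * (R / r) powr t * (2 * r) powr s)"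
      by (intro ennreal_leI mult_right_mono F(3)) simp
    finally show ?thesis .
  qed
  have "hausdorff_premeasure X d s \<delta> \<le> 0" if "0 < \<delta>" for \<delta>
  proof (rule tendsto_lowerbound)
    have pos: "\<forall>\<^sub>F r in at_right (0::real). 0 < r" by (rule eventually_at_right_less)
    have "((\<lambda>r. r powr (s - t)) \<longlongrightarrow> 0) (at_right 0)"
    proof (rule tendsto_zero_powrI)
      show "\<forall>\<^sub>F r in at_right (0::real). 0 \<le> r" using pos by eventually_elim simp
      show "((\<lambda>r. s - t) \<longlongrightarrow> s - t) (at_right (0::real))" by (rule tendsto_const)
    qed (use \<open>t < s\<close> in \<open>simp_all add: tendsto_ident_at\<close>)
    then have "((\<lambda>r. C * R powr t * 2 powr s * r powr (s - t)) \<longlongrightarrow> 0) (at_right 0)"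
      by (rule tendsto_mult_right_zero)
    moreover have "\<forall>\<^sub>F r in at_right 0. C * R powr t * 2 powr s * r powr (s - t) =
        C * (R / r) powr t * (2 * r) powr s"
      using pos
    proof eventually_elim
      case (elim r)
      then show ?case using \<open>0 < R\<close> by (simp add: powr_divide powr_mult powr_diff)
    qed
    ultimately have "((\<lambda>r. C * (R / r) powr t * (2 * r) powr s) \<longlongrightarrow> 0) (at_right 0)"
      by (rule Lim_transform_eventually)
    then show "((\<lambda>r. ennreal (C * (R / r) powr t * (2 * r) powr s)) \<longlongrightarrow> 0) (at_right 0)"
      by (metis tendsto_ennrealI ennreal_0)
    have "\<forall>\<^sub>F r in at_right 0. r \<in> {0<..<min R (\<delta> / 2)}"
      using \<open>0 < R\<close> that by (intro eventually_at_right_real) auto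
    then show "\<forall>\<^sub>F r in at_right 0. hausdorff_premeasure X d s \<delta> \<le> ennreal (C * (R / r) powr t * (2 * r) powr s)"
      by eventually_elim (intro bound, auto)
  qed simp
  then show ?thesis unfolding hausdorff_measure_def by (simp add: SUP_eq_const order.antisym bot_unique)
qed

text \<open>
  A bounded space is itself a ball, so that the covering condition of the Assouad dimension applies
  to the whole space.
\<close>

lemma hausdorff_dim_le_assouad_dim:
  assumes M: "Metric_space X d" and "x0 \<in> X" and bounded: "\<And>y. y \<in> X \<Longrightarrow> d x0 y < R"
  shows "hausdorff_dim X d \<le> assouad_dim X d"
  unfolding assouad_dim_def
proof (rule Inf_greatest, clarify)
  interpret Metric_space X d by (rule M)
  fix t C :: real
  assume t: "0 \<le> t" "1 \<le> C" and cover: "\<forall>x\<in>X. \<forall>r R. 0 < r \<and> r < R \<longrightarrow>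
    (\<exists>F\<subseteq>X. finite F \<and> real (card F) \<le> C * (R / r) powr t \<and> mball x R \<subseteq> (\<Union>y\<in>F. mball y r))"
  have ball: "mball x0 R = X" unfolding mball_def using \<open>x0 \<in> X\<close> bounded by blast
  have "0 < R" using bounded[OF \<open>x0 \<in> X\<close>] nonneg[of x0 x0] by linarith
  show "hausdorff_dim X d \<le> ennreal t"
  proof (rule ennreal_le_epsilon)
    fix e :: real assume "0 < e"
    have "hausdorff_measure X d (t + e) = 0"
    proof (rule hausdorff_measure_eq_0[OF M])
      show "\<exists>F\<subseteq>X. finite F \<and> real (card F) \<le> C * (R / r) powr t \<and> X \<subseteq> (\<Union>y\<in>F. mball y r)"
        if "0 < r" "r < R" for r
        using cover[rule_format, OF \<open>x0 \<in> X\<close>, of r R] that unfolding ball by blast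
    qed (use t \<open>0 < e\<close> \<open>0 < R\<close> in simp_all)
    then have "hausdorff_dim X d \<le> ennreal (t + e)"
      unfolding hausdorff_dim_def using t \<open>0 < e\<close>
      by (intro Inf_lower CollectI exI[of _ "t + e"]) simp
    also have "\<dots> = ennreal t + ennreal e" using t \<open>0 < e\<close> by (intro ennreal_plus) simp_all
    finally show "hausdorff_dim X d \<le> ennreal t + ennreal e" .
  qed
qed

section \<open>Covers by sets of small diameter\<close>

text \<open>
  Unlike covers by balls, covers by arbitrary sets of diameter less than \<open>r\<close> need no centres, so
  that they can be given by labelling points and can be cut down to subsets.
\<close>

definition small_cover :: "('a \<Rightarrow> 'a \<Rightarrow> real) \<Rightarrow> real \<Rightarrow> 'a set \<Rightarrow> real \<Rightarrow> bool" where
  "small_cover d r B N \<longleftrightarrow> (\<exists>P. finite P \<and> real (card P) \<le> N \<and> B \<subseteq> \<Union>P \<and>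
     (\<forall>U\<in>P. \<forall>p\<in>U. \<forall>q\<in>U. d p q < r))"

lemma small_cover_labels:
  assumes "finite J" "f ` B \<subseteq> J" "real (card J) \<le> N"
    and "\<And>p q. p \<in> B \<Longrightarrow> q \<in> B \<Longrightarrow> f p = f q \<Longrightarrow> d p q < r"
  shows "small_cover d r B N"
  unfolding small_cover_def
proof (intro exI[of _ "(\<lambda>j. {p \<in> B. f p = j}) ` J"] conjI)
  show "real (card ((\<lambda>j. {p \<in> B. f p = j}) ` J)) \<le> N"
    using card_image_le[OF assms(1), of "\<lambda>j. {p \<in> B. f p = j}"] assms(3) by linarith
qed (use assms in auto)

lemma small_cover_mono: "small_cover d r B N \<Longrightarrow> A \<subseteq> B \<Longrightarrow> N \<le> M \<Longrightarrow> small_cover d r A M"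
  unfolding small_cover_def by (meson order_trans)

lemma small_cover_Un:
  assumes "small_cover d r A M" "small_cover d r B N"
  shows "small_cover d r (A \<union> B) (M + N)"
proof -
  obtain P where P: "finite P" "real (card P) \<le> M" "A \<subseteq> \<Union>P" "\<forall>U\<in>P. \<forall>p\<in>U. \<forall>q\<in>U. d p q < r"
    using assms(1) unfolding small_cover_def by (elim exE conjE) (rule that)
  obtain Q where Q: "finite Q" "real (card Q) \<le> N" "B \<subseteq> \<Union>Q" "\<forall>U\<in>Q. \<forall>p\<in>U. \<forall>q\<in>U. d p q < r"
    using assms(2) unfolding small_cover_def by (elim exE conjE) (rule that)
  show ?thesis
    unfolding small_cover_def
  proof (intro exI[of _ "P \<union> Q"] conjI ballI)
    show "A \<union> B \<subseteq> \<Union> (P \<union> Q)" using P(3) Q(3) by blast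
    show "d p q < r" if "U \<in> P \<union> Q" "p \<in> U" "q \<in> U" for U p q using P(4) Q(4) that by blast
    show "real (card (P \<union> Q)) \<le> M + N" using card_Un_le[of P Q] P(2) Q(2) by linarith
  qed (use P(1) Q(1) in simp)
qed

lemma small_cover_UN:
  assumes "finite I" "\<And>i. i \<in> I \<Longrightarrow> small_cover d r (B i) (N i)"
  shows "small_cover d r (\<Union>i\<in>I. B i) (\<Sum>i\<in>I. N i)"
  using assms
proof (induction I rule: finite_induct)
  case empty
  show ?case unfolding small_cover_def by (intro exI[of _ "{}"]) simp
next
  case (insert i I)
  then show ?case by (simp add: small_cover_Un)
qed

text \<open>
  A set of diameter less than \<open>r\<close> lies in the \<open>r\<close>-ball around any of its points.
\<close>

lemma (in Metric_space) small_cover_balls: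
  assumes "small_cover d r B N" "B \<subseteq> M"
  shows "\<exists>F\<subseteq>M. finite F \<and> real (card F) \<le> N \<and> B \<subseteq> (\<Union>y\<in>F. mball y r)"
proof -
  obtain P where P: "finite P" "real (card P) \<le> N" "B \<subseteq> \<Union>P" "\<forall>U\<in>P. \<forall>p\<in>U. \<forall>q\<in>U. d p q < r"
    using assms(1) unfolding small_cover_def by (elim exE conjE) (rule that)
  define Q where "Q = {U \<in> P. U \<inter> B \<noteq> {}}"
  have Q: "finite Q" "card Q \<le> card P" using P(1) unfolding Q_def by (auto intro: card_mono)
  have "\<forall>U\<in>Q. \<exists>y. y \<in> U \<inter> B" unfolding Q_def by blast
  then obtain f where f: "\<And>U. U \<in> Q \<Longrightarrow> f U \<in> U \<inter> B" by metis
  show ?thesis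
  proof (intro exI[of _ "f ` Q"] conjI)
    show "f ` Q \<subseteq> M" using f assms(2) by blast
    show "finite (f ` Q)" using Q by simp
    show "real (card (f ` Q)) \<le> N" using card_image_le[OF Q(1), of f] Q(2) P(2) by linarith
    show "B \<subseteq> (\<Union>y\<in>f ` Q. mball y r)"
    proof
      fix p assume "p \<in> B"
      then obtain U where U: "U \<in> P" "p \<in> U" using P(3) by blast
      then have "U \<in> Q" using \<open>p \<in> B\<close> unfolding Q_def by blast
      then show "p \<in> (\<Union>y\<in>f ` Q. mball y r)"
        using f[of U] P(4) U \<open>p \<in> B\<close> assms(2) by (intro UN_I[of "f U"]) auto
    qed
  qed
qed

lemma card_floor_range:
  fixes \<eta> u v :: real
  assumes "u \<le> v" "0 < \<eta>"
  shows "real (card {\<lfloor>u / \<eta>\<rfloor>..\<lfloor>v / \<eta>\<rfloor>}) \<le> (v - u) / \<eta> + 2"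
proof -
  have "\<lfloor>u / \<eta>\<rfloor> \<le> \<lfloor>v / \<eta>\<rfloor>" using assms by (intro floor_mono divide_right_mono) auto
  then have "real (card {\<lfloor>u / \<eta>\<rfloor>..\<lfloor>v / \<eta>\<rfloor>}) = \<lfloor>v / \<eta>\<rfloor> - \<lfloor>u / \<eta>\<rfloor> + 1" by simp
  also have "\<dots> \<le> v / \<eta> - u / \<eta> + 2" by linarith
  finally show ?thesis by (simp add: diff_divide_distrib)
qed

lemma floor_eq_imp_close:
  fixes u v \<eta> :: real
  assumes "\<lfloor>u / \<eta>\<rfloor> = \<lfloor>v / \<eta>\<rfloor>" "0 < \<eta>"
  shows "\<bar>u - v\<bar> < \<eta>"
proof -
  have "\<bar>u / \<eta> - v / \<eta>\<bar> < 1" using assms(1) by linarith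
  then have "\<bar>(u - v) / \<eta>\<bar> < 1" by (simp only: diff_divide_distrib)
  then show ?thesis using assms(2) by (simp add: abs_divide)
qed

text \<open>
  A set of real numbers of diameter at most \<open>s\<close> meets at most two neighbouring cells of a
  subdivision of the line into cells of length \<open>2s\<close>.
\<close>

lemma floor_two_values:
  fixes u :: "'a \<Rightarrow> real"
  assumes "0 < s" and close: "\<And>p q. p \<in> A \<Longrightarrow> q \<in> A \<Longrightarrow> \<bar>u p - u q\<bar> \<le> s"
  shows "\<exists>m. \<forall>q\<in>A. \<lfloor>u q / (2 * s)\<rfloor> \<in> {m, m + 1}"
proof -
  have near: "\<lfloor>u q / (2 * s)\<rfloor> \<le> \<lfloor>u p / (2 * s)\<rfloor> + 1" if "p \<in> A" "q \<in> A" for p q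
  proof -
    have "u q / (2 * s) - u p / (2 * s) = (u q - u p) / (2 * s)" by (rule diff_divide_distrib[symmetric])
    also have "\<dots> \<le> 1" using close[OF that(2,1)] \<open>0 < s\<close> by simp
    finally show ?thesis by linarith
  qed
  show ?thesis
  proof (cases "\<exists>p\<in>A. \<exists>q\<in>A. \<lfloor>u q / (2 * s)\<rfloor> < \<lfloor>u p / (2 * s)\<rfloor>")
    case True
    then obtain p q where pq: "p \<in> A" "q \<in> A" "\<lfloor>u q / (2 * s)\<rfloor> < \<lfloor>u p / (2 * s)\<rfloor>" by blast
    have "\<lfloor>u x / (2 * s)\<rfloor> \<in> {\<lfloor>u q / (2 * s)\<rfloor>, \<lfloor>u q / (2 * s)\<rfloor> + 1}" if "x \<in> A" for x
      using near[OF pq(2) that] near[OF that pq(1)] pq(3) by auto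
    then show ?thesis by blast
  next
    case False
    then have "\<lfloor>u p / (2 * s)\<rfloor> = \<lfloor>u q / (2 * s)\<rfloor>" if "p \<in> A" "q \<in> A" for p q
      using that by (meson linorder_neqE)
    then show ?thesis by (metis insertCI)
  qed
qed

lemma harm_le:
  assumes "1 \<le> n"
  shows "harm n \<le> 1 + ln (real n)"
proof -
  obtain k where k: "n = Suc k" using assms by (cases n) simp_all
  have "harm (Suc k) - ln (real (Suc k)) \<le> harm (Suc 0) - ln (real (Suc 0))"
    using decseqD[OF decseq_harm_diff_ln, of 0 k] by simp
  then show ?thesis unfolding k by (simp add: harm_def)
qed

section \<open>Combs and their path metric\<close>

text \<open>
  The length of the only arc from \<open>p\<close> to \<open>q\<close>: along one tooth, or down a tooth, along the base and
  up another tooth.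
\<close>

definition comb_dist :: "real \<times> real \<Rightarrow> real \<times> real \<Rightarrow> real" where
  "comb_dist p q =
     (if fst p = fst q then \<bar>snd p - snd q\<bar> else \<bar>snd p\<bar> + \<bar>fst p - fst q\<bar> + \<bar>snd q\<bar>)"

text \<open>
  The base is the unit interval of the horizontal axis, and the part of the comb over each of its points
  is a vertical interval that contains the base point. The assumption \<open>gap\<close> says that long teeth are
  far apart; it keeps points at a large path distance apart in the plane and limits the number of
  teeth of a given length.
\<close>

locale comb =
  fixes S :: "(real \<times> real) set"
  assumes base: "x \<in> {0..1} \<Longrightarrow> (x, 0) \<in> S"
    and over_base: "(x, h) \<in> S \<Longrightarrow> x \<in> {0..1}"
    and tooth: "(x, h) \<in> S \<Longrightarrow> u \<in> closed_segment 0 h \<Longrightarrow> (x, u) \<in> S"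
    and height: "(x, h) \<in> S \<Longrightarrow> \<bar>h\<bar> \<le> 1"
    and gap: "(x, h) \<in> S \<Longrightarrow> (x', h') \<in> S \<Longrightarrow> x \<noteq> x' \<Longrightarrow> min \<bar>h\<bar> \<bar>h'\<bar> \<le> \<bar>x - x'\<bar>"
begin

text \<open>
  A path that avoids the base stays at heights at least some \<open>\<epsilon> > 0\<close> by compactness. By the gap
  condition, its horizontal coordinate can change only in jumps of size at least \<open>\<epsilon>\<close>, hence not
  at all.
\<close>

lemma constant_off_base:
  assumes g: "path g" "path_image g \<subseteq> S" and "0 \<le> t" "t \<le> 1"
    and off: "\<And>u. 0 \<le> u \<Longrightarrow> u \<le> t \<Longrightarrow> snd (g u) \<noteq> 0"
  shows "fst (g t) = fst (g 0)"
proof -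
  have c: "continuous_on {0..t} g"
    using g(1) unfolding path_def by (rule continuous_on_subset) (use \<open>t \<le> 1\<close> in auto)
  have "continuous_on {0..t} (\<lambda>u. \<bar>snd (g u)\<bar>)" by (intro continuous_intros c)
  then obtain v where v: "v \<in> {0..t}" "\<And>u. u \<in> {0..t} \<Longrightarrow> \<bar>snd (g v)\<bar> \<le> \<bar>snd (g u)\<bar>"
    using continuous_attains_inf[of "{0..t}" "\<lambda>u. \<bar>snd (g u)\<bar>"] \<open>0 \<le> t\<close> by auto
  have gS: "(fst (g u), snd (g u)) \<in> S" if "u \<in> {0..t}" for u
    using g(2) that \<open>t \<le> 1\<close> by (auto simp: path_image_def)
  have "(\<lambda>u. fst (g u)) constant_on {0..t}"
  proof (rule continuous_discrete_range_constant)
    show "connected {0..t}" by simp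
    show "continuous_on {0..t} (\<lambda>u. fst (g u))" by (intro continuous_intros c)
    fix u assume u: "u \<in> {0..t}"
    show "\<exists>e>0. \<forall>y. y \<in> {0..t} \<and> fst (g y) \<noteq> fst (g u) \<longrightarrow> e \<le> norm (fst (g y) - fst (g u))"
    proof (intro exI[of _ "\<bar>snd (g v)\<bar>"] conjI allI impI)
      show "0 < \<bar>snd (g v)\<bar>" using off v(1) by simp
      fix y assume y: "y \<in> {0..t} \<and> fst (g y) \<noteq> fst (g u)"
      then have "min \<bar>snd (g y)\<bar> \<bar>snd (g u)\<bar> \<le> \<bar>fst (g y) - fst (g u)\<bar>"
        using gap[OF gS gS] u by blast
      then show "\<bar>snd (g v)\<bar> \<le> norm (fst (g y) - fst (g u))"
        using v(2)[OF u] v(2)[of y] y unfolding real_norm_def by linarith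
    qed
  qed
  then obtain k where "\<forall>u\<in>{0..t}. fst (g u) = k" unfolding constant_on_def by blast
  then show ?thesis using \<open>0 \<le> t\<close> by simp
qed

text \<open>
  A path between different teeth has to leave the first one through the foot of that tooth: up to the
  first time \<open>T\<close> at which it reaches the base its horizontal coordinate is constant, by
  \<open>constant_off_base\<close>, and by continuity this still holds at time \<open>T\<close>.
\<close>

lemma first_base_point:
  assumes g: "path g" "path_image g \<subseteq> S" and ne: "fst (g 0) \<noteq> fst (g 1)"
  shows "\<exists>T\<in>{0..1}. g T = (fst (g 0), 0) \<and> (\<forall>t\<in>{0..1}. snd (g t) = 0 \<longrightarrow> T \<le> t)"
proof -
  define Z where "Z = {t \<in> {0..1}. snd (g t) = 0}"
  have c: "continuous_on {0..1} g" using g(1) unfolding path_def .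
  have "Z \<noteq> {}"
  proof
    assume "Z = {}"
    then have "snd (g u) \<noteq> 0" if "0 \<le> u" "u \<le> 1" for u using that unfolding Z_def by auto
    then show False using constant_off_base[OF g, of 1] ne by simp
  qed
  moreover have "closed Z"
    unfolding Z_def by (rule continuous_closed_preimage_constant[OF continuous_on_snd[OF c]]) simp
  moreover have "bdd_below Z" unfolding Z_def by (rule bdd_belowI[of _ 0]) auto
  ultimately have "Inf Z \<in> Z \<and> (\<forall>t\<in>Z. Inf Z \<le> t)"
    by (simp add: closed_contains_Inf cInf_lower)
  then obtain T where TZ: "T \<in> Z" and least: "\<And>t. t \<in> Z \<Longrightarrow> T \<le> t"
    by blast
  have T01: "0 \<le> T" "T \<le> 1" "snd (g T) = 0" using TZ unfolding Z_def by simp_all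
  have before: "fst (g t) = fst (g 0)" if t: "0 \<le> t" "t < T" for t
  proof (rule constant_off_base[OF g \<open>0 \<le> t\<close>])
    show "t \<le> 1" using t T01 by linarith
    show "snd (g u) \<noteq> 0" if "0 \<le> u" "u \<le> t" for u
    proof
      assume "snd (g u) = 0"
      then have "u \<in> Z" using that t T01 unfolding Z_def by simp
      then show False using least[of u] that t by linarith
    qed
  qed
  have "fst (g T) = fst (g 0)"
  proof (cases "T = 0")
    case False
    then have "0 < T" using T01 by simp
    have "continuous_on {0..T} (\<lambda>t. fst (g t))"
      using T01 by (intro continuous_on_fst continuous_on_subset[OF c]) simp
    then have "continuous_on (closure {0..<T}) (\<lambda>t. fst (g t))"
      using \<open>0 < T\<close> by (simp add: closure_atLeastLessThan)
    then show ?thesis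
    proof (rule continuous_constant_on_closure)
      show "fst (g t) = fst (g 0)" if "t \<in> {0..<T}" for t
        by (rule before) (use that in simp_all)
      show "T \<in> closure {0..<T}" using \<open>0 < T\<close> by (simp add: closure_atLeastLessThan)
    qed
  qed simp
  then have "g T = (fst (g 0), 0)" using T01 by (simp add: prod_eq_iff)
  moreover have "\<forall>t\<in>{0..1}. snd (g t) = 0 \<longrightarrow> T \<le> t"
    using least unfolding Z_def by simp
  ultimately show ?thesis using T01 by (intro bexI[of _ T]) simp_all
qed

lemma path_length_ge_comb_dist:
  assumes g: "path g" "path_image g \<subseteq> S"
  shows "ennreal (comb_dist (g 0) (g 1)) \<le> path_length g"
proof (cases "fst (g 0) = fst (g 1)")
  case True
  then have "comb_dist (g 0) (g 1) = dist (g 0) (g 1)"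
    by (simp add: comb_dist_def dist_prod_def dist_real_def)
  then show ?thesis using path_length_ge_three[of 0 1 g] by simp
next
  case False
  obtain T where T: "T \<in> {0..1}" "g T = (fst (g 0), 0)" "\<And>t. t \<in> {0..1} \<Longrightarrow> snd (g t) = 0 \<Longrightarrow> T \<le> t"
    using first_base_point[OF g False] by blast
  \<comment> \<open>The last time on the base is the first one of the reversed path.\<close>
  let ?r = "reversepath g"
  have r: "path ?r" "path_image ?r \<subseteq> S" using g by simp_all
  have r01: "?r 0 = g 1" "?r 1 = g 0" by (simp_all add: reversepath_def)
  obtain U where U: "U \<in> {0..1}" "?r U = (fst (g 1), 0)" "\<And>t. t \<in> {0..1} \<Longrightarrow> snd (?r t) = 0 \<Longrightarrow> U \<le> t"
    using first_base_point[OF r] False unfolding r01 by metis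
  have "U \<le> 1 - T" using U(3)[of "1 - T"] T by (simp add: reversepath_def)
  moreover have "g (1 - U) = (fst (g 1), 0)" using U(2) by (simp add: reversepath_def)
  moreover have "comb_dist (g 0) (g 1) =
      dist (g 0) (fst (g 0), 0) + dist (fst (g 0), 0::real) (fst (g 1), 0) + dist (fst (g 1), 0) (g 1)"
    using False by (simp add: comb_dist_def dist_prod_def dist_real_def)
  ultimately show ?thesis
    using path_length_ge_three[of T "1 - U" g] T U by auto
qed

lemma vertical_segment:
  assumes "(x, h) \<in> S" "(x, h') \<in> S"
  shows "closed_segment (x, h) (x, h') \<subseteq> S"
proof
  fix z assume "z \<in> closed_segment (x, h) (x, h')"
  then obtain t where t: "0 \<le> t" "t \<le> 1" "z = (1 - t) *\<^sub>R (x, h) + t *\<^sub>R (x, h')"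
    unfolding closed_segment_def by blast
  define u where "u = (1 - t) *\<^sub>R h + t *\<^sub>R h'"
  have u: "z = (x, u)" "u \<in> closed_segment h h'"
    using t unfolding closed_segment_def u_def by (auto simp: left_diff_distrib)
  then have "u \<in> closed_segment 0 h \<or> u \<in> closed_segment 0 h'"
    by (auto simp: closed_segment_eq_real_ivl split: if_splits)
  then show "z \<in> S" using assms tooth u by blast
qed

lemma base_segment:
  assumes "x \<in> {0..1}" "x' \<in> {0..1}"
  shows "closed_segment (x, 0) (x', 0) \<subseteq> S"
proof
  fix z assume "z \<in> closed_segment (x, 0) (x', 0::real)"
  then obtain t where t: "0 \<le> t" "t \<le> 1" "z = (1 - t) *\<^sub>R (x, 0) + t *\<^sub>R (x', 0)"
    unfolding closed_segment_def by blast
  define u where "u = (1 - t) *\<^sub>R x + t *\<^sub>R x'"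
  have u: "z = (u, 0)" "u \<in> closed_segment x x'"
    using t unfolding closed_segment_def u_def by auto
  then have "u \<in> {0..1}" using assms by (auto simp: closed_segment_eq_real_ivl split: if_splits)
  then show "z \<in> S" using base u by simp
qed

lemma shortest_path:
  assumes "p \<in> S" "q \<in> S"
  shows "\<exists>g. path g \<and> path_image g \<subseteq> S \<and> pathstart g = p \<and> pathfinish g = q \<and>
    length_bounded g (comb_dist p q)"
proof -
  obtain x h x' h' where pq: "p = (x, h)" "q = (x', h')" by fastforce
  show ?thesis
  proof (cases "x = x'")
    case True
    then have "comb_dist p q = dist p q"
      using pq by (simp add: comb_dist_def dist_prod_def dist_real_def)
    then show ?thesis
      using length_bounded_linepath[of p q] vertical_segment[of x h h'] True assms pq
      by (intro exI[of _ "linepath p q"]) auto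
  next
    case False
    let ?g = "linepath p (x, 0) +++ (linepath (x, 0) (x', 0) +++ linepath (x', 0) q)"
    have x: "x \<in> {0..1}" "x' \<in> {0..1}" using over_base assms pq by auto
    have "comb_dist p q = dist p (x, 0) + (dist (x, 0) (x', 0::real) + dist (x', 0) q)"
      using pq False by (simp add: comb_dist_def dist_prod_def dist_real_def)
    then have "length_bounded ?g (comb_dist p q)"
      by (simp add: length_bounded_join length_bounded_linepath)
    moreover have "path_image ?g \<subseteq> S"
      using vertical_segment[of x h 0] vertical_segment[of x' 0 h'] base_segment[OF x] x base assms pq
      by (simp add: path_image_join)
    ultimately show ?thesis by (intro exI[of _ ?g]) simp
  qed
qed

theorem path_dist_eq_comb_dist:
  assumes "p \<in> S" "q \<in> S"
  shows "path_dist S p q = comb_dist p q"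
proof -
  let ?P = "{g. path g \<and> path_image g \<subseteq> S \<and> pathstart g = p \<and> pathfinish g = q}"
  have "(INF g\<in>?P. path_length g) = ennreal (comb_dist p q)"
  proof (rule antisym)
    obtain g where "g \<in> ?P" "length_bounded g (comb_dist p q)"
      using shortest_path[OF assms] by blast
    then show "(INF g\<in>?P. path_length g) \<le> ennreal (comb_dist p q)"
      using path_length_le_length_bounded by (intro INF_lower2) auto
    show "ennreal (comb_dist p q) \<le> (INF g\<in>?P. path_length g)"
      using path_length_ge_comb_dist by (intro INF_greatest) (auto simp: pathstart_def pathfinish_def)
  qed
  then show ?thesis unfolding path_dist_def by (simp add: comb_dist_def)
qed

lemma Metric_space_path_dist: "Metric_space S (path_dist S)"
proof
  fix p q show "0 \<le> path_dist S p q" unfolding path_dist_def by simp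
  show "path_dist S p q = path_dist S q p"
    by (cases "p \<in> S \<and> q \<in> S")
      (auto simp: path_dist_outside path_dist_eq_comb_dist comb_dist_def)
next
  fix p q assume "p \<in> S" "q \<in> S"
  then show "path_dist S p q = 0 \<longleftrightarrow> p = q"
    by (auto simp: path_dist_eq_comb_dist comb_dist_def prod_eq_iff)
next
  fix p q r assume "p \<in> S" "q \<in> S" "r \<in> S"
  moreover have "comb_dist p r \<le> comb_dist p q + comb_dist q r"
    by (cases "fst p = fst q"; cases "fst q = fst r"; cases "fst p = fst r"; simp add: comb_dist_def; linarith)
  ultimately show "path_dist S p r \<le> path_dist S p q + path_dist S q r"
    by (simp add: path_dist_eq_comb_dist)
qed

section \<open>The plane drawing of a comb\<close>

text \<open>
  For points of different teeth, the smaller height is at most the horizontal distance by the gap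
  condition, and the heights differ by at most the vertical distance. Hence their sum is at most three
  times the Euclidean distance.
\<close>

lemma comb_dist_le_euclidean:
  assumes "p \<in> S" "q \<in> S"
  shows "comb_dist p q \<le> 4 * dist p q"
proof -
  have f: "\<bar>fst p - fst q\<bar> \<le> dist p q" using dist_fst_le[of p q] by (simp add: dist_real_def)
  have s: "\<bar>snd p - snd q\<bar> \<le> dist p q" using dist_snd_le[of p q] by (simp add: dist_real_def)
  show ?thesis
  proof (cases "fst p = fst q")
    case True then show ?thesis using s zero_le_dist[of p q] by (simp add: comb_dist_def)
  next
    case False
    then have "min \<bar>snd p\<bar> \<bar>snd q\<bar> \<le> \<bar>fst p - fst q\<bar>"
      using gap[of "fst p" "snd p" "fst q" "snd q"] assms by simp
    then show ?thesis using False f s unfolding comb_dist_def by auto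
  qed
qed

lemma dist_le_comb_dist: "dist p q \<le> comb_dist p q"
proof -
  have "dist p q \<le> \<bar>fst p - fst q\<bar> + \<bar>snd p - snd q\<bar>"
    unfolding dist_prod_def dist_real_def by (rule sqrt_sum_squares_le_sum_abs[THEN order_trans]) simp
  then show ?thesis unfolding comb_dist_def by auto
qed

theorem bilipschitz_in_plane:
  "\<exists>f :: real \<times> real \<Rightarrow> real ^ 2. bilipschitz_embedding S (path_dist S) f"
proof (intro exI[of _ "\<lambda>p. vector [fst p, snd p]"])
  have iso: "dist (vector [fst p, snd p] :: real ^ 2) (vector [fst q, snd q]) = dist p q"
    for p q :: "real \<times> real"
    by (simp add: dist_vec_def L2_set_def sum_2 dist_prod_def)
  show "bilipschitz_embedding S (path_dist S) (\<lambda>p. vector [fst p, snd p] :: real ^ 2)"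
    unfolding bilipschitz_embedding_def iso
  proof (rule exI[of _ 4], rule conjI, simp, rule exI[of _ 1], intro conjI ballI)
    fix p q assume "p \<in> S" "q \<in> S"
    then show "1 / 4 * path_dist S p q \<le> dist p q" "dist p q \<le> 1 * path_dist S p q"
      using comb_dist_le_euclidean[of p q] dist_le_comb_dist[of p q]
      by (simp_all add: path_dist_eq_comb_dist)
  qed simp_all
qed

section \<open>Dimensions of a comb\<close>

lemma abs_fst_le_comb_dist: "\<bar>fst p - fst q\<bar> \<le> comb_dist p q"
  by (simp add: comb_dist_def)

text \<open>
  The projection to the base does not increase distances.
\<close>

lemma hausdorff_dim_ge: "1 \<le> hausdorff_dim S (path_dist S)"
proof (rule hausdorff_dim_ge_1[where \<pi> = fst])
  show "\<bar>fst p - fst q\<bar> \<le> path_dist S p q" if "p \<in> S" "q \<in> S" for p q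
    using abs_fst_le_comb_dist path_dist_eq_comb_dist[OF that] by simp
  show "{0..1} \<subseteq> fst ` S"
  proof
    fix x :: real assume "x \<in> {0..1}"
    then show "x \<in> fst ` S" using base[of x] by (intro image_eqI[of _ _ "(x, 0)"]) simp_all
  qed
qed

lemma small_cover_fibre:
  assumes "0 < \<eta>" "0 < R"
  shows "small_cover (path_dist S) \<eta> {q \<in> S. fst q = x0 \<and> \<bar>snd q - h0\<bar> < R} (2 * R / \<eta> + 2)"
proof (rule small_cover_labels)
  let ?J = "{\<lfloor>(h0 - R) / \<eta>\<rfloor>..\<lfloor>(h0 + R) / \<eta>\<rfloor>}"
  show "(\<lambda>q. \<lfloor>snd q / \<eta>\<rfloor>) ` {q \<in> S. fst q = x0 \<and> \<bar>snd q - h0\<bar> < R} \<subseteq> ?J"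
    using assms by (auto intro!: floor_mono divide_right_mono)
  show "real (card ?J) \<le> 2 * R / \<eta> + 2"
    using card_floor_range[of "h0 - R" "h0 + R" \<eta>] assms by simp
  fix p q assume "p \<in> {q \<in> S. fst q = x0 \<and> \<bar>snd q - h0\<bar> < R}" "q \<in> {q \<in> S. fst q = x0 \<and> \<bar>snd q - h0\<bar> < R}"
    and "\<lfloor>snd p / \<eta>\<rfloor> = \<lfloor>snd q / \<eta>\<rfloor>"
  then show "path_dist S p q < \<eta>"
    using floor_eq_imp_close assms by (simp add: path_dist_eq_comb_dist comb_dist_def)
qed simp

lemma small_cover_base:
  assumes "0 < \<eta>" "0 < R"
  shows "small_cover (path_dist S) (3 * \<eta>) {q \<in> S. \<bar>fst q - x0\<bar> < R \<and> \<bar>snd q\<bar> < \<eta>} (2 * R / \<eta> + 2)"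
proof (rule small_cover_labels)
  let ?B = "{q \<in> S. \<bar>fst q - x0\<bar> < R \<and> \<bar>snd q\<bar> < \<eta>}"
  let ?J = "{\<lfloor>(x0 - R) / \<eta>\<rfloor>..\<lfloor>(x0 + R) / \<eta>\<rfloor>}"
  show "(\<lambda>q. \<lfloor>fst q / \<eta>\<rfloor>) ` ?B \<subseteq> ?J"
    using assms by (auto intro!: floor_mono divide_right_mono)
  show "real (card ?J) \<le> 2 * R / \<eta> + 2"
    using card_floor_range[of "x0 - R" "x0 + R" \<eta>] assms by simp
  fix p q assume pq: "p \<in> ?B" "q \<in> ?B" "\<lfloor>fst p / \<eta>\<rfloor> = \<lfloor>fst q / \<eta>\<rfloor>"
  then have "\<bar>snd p\<bar> < \<eta>" "\<bar>snd q\<bar> < \<eta>" "\<bar>fst p - fst q\<bar> < \<eta>"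
    using floor_eq_imp_close assms by auto
  then have "comb_dist p q < 3 * \<eta>" unfolding comb_dist_def by (smt (verit))
  then show "path_dist S p q < 3 * \<eta>"
    using pq by (simp add: path_dist_eq_comb_dist)
qed simp

text \<open>
  By the gap condition, the teeth of height at least \<open>m\<eta>\<close> are \<open>m\<eta>\<close> apart, so that a cell of length
  \<open>m\<eta>\<close> of the base determines the tooth; the second label tells the upward from the downward part
  of a tooth that crosses the base.
\<close>

lemma small_cover_layer:
  assumes "0 < \<eta>" "0 < R" "1 \<le> (m :: nat)"
  shows "small_cover (path_dist S) \<eta>
    {q \<in> S. \<bar>fst q - x0\<bar> < R \<and> m * \<eta> \<le> \<bar>snd q\<bar> \<and> \<bar>snd q\<bar> < (m + 1) * \<eta>} (4 * (R / \<eta>) / m + 4)"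
proof (rule small_cover_labels)
  let ?B = "{q \<in> S. \<bar>fst q - x0\<bar> < R \<and> m * \<eta> \<le> \<bar>snd q\<bar> \<and> \<bar>snd q\<bar> < (m + 1) * \<eta>}"
  let ?I = "{\<lfloor>(x0 - R) / (m * \<eta>)\<rfloor>..\<lfloor>(x0 + R) / (m * \<eta>)\<rfloor>}"
  have m\<eta>: "0 < m * \<eta>" using assms by simp
  let ?f = "\<lambda>q :: real \<times> real. (\<lfloor>fst q / (m * \<eta>)\<rfloor>, 0 \<le> snd q)"
  have "\<lfloor>fst q / (m * \<eta>)\<rfloor> \<in> ?I" if "q \<in> ?B" for q
    using that m\<eta> by (auto intro!: floor_mono divide_right_mono)
  then show "?f ` ?B \<subseteq> ?I \<times> UNIV" by blast
  have "real (card (?I \<times> (UNIV :: bool set))) = 2 * real (card ?I)"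
    by (simp only: card_cartesian_product card_UNIV_bool of_nat_mult of_nat_numeral mult.commute)
  also have "\<dots> \<le> 2 * ((x0 + R - (x0 - R)) / (m * \<eta>) + 2)"
    using assms m\<eta> by (intro mult_left_mono card_floor_range) auto
  also have "\<dots> = 4 * (R / \<eta>) / m + 4" using assms by (simp add: field_simps)
  finally show "real (card (?I \<times> (UNIV :: bool set))) \<le> 4 * (R / \<eta>) / m + 4" .
  fix p q assume pq: "p \<in> ?B" "q \<in> ?B" "?f p = ?f q"
  then have S: "(fst p, snd p) \<in> S" "(fst q, snd q) \<in> S" by simp_all
  have "\<bar>fst p - fst q\<bar> < m * \<eta>" using pq(3) floor_eq_imp_close m\<eta> by blast
  moreover have "m * \<eta> \<le> min \<bar>snd p\<bar> \<bar>snd q\<bar>" using pq(1,2) by simp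
  ultimately have same: "fst p = fst q" using gap[OF S] by linarith
  have "m * \<eta> \<le> \<bar>snd p\<bar>" "m * \<eta> \<le> \<bar>snd q\<bar>" "\<bar>snd p\<bar> < m * \<eta> + \<eta>" "\<bar>snd q\<bar> < m * \<eta> + \<eta>"
    "0 \<le> snd p \<longleftrightarrow> 0 \<le> snd q"
    using pq by (auto simp: algebra_simps)
  then have "\<bar>snd p - snd q\<bar> < \<eta>" by linarith
  then show "path_dist S p q < \<eta>"
    using same pq by (simp add: path_dist_eq_comb_dist comb_dist_def)
qed simp

text \<open>
  The ball of radius \<open>R\<close> around \<open>p\<close> consists of points on the tooth of \<open>p\<close>, points near the base, and
  points of other teeth, which lie at heights less than \<open>R\<close>. The last ones are sorted into layers
  of thickness \<open>\<eta>\<close>; the \<open>m\<close>-th layer needs about \<open>\<rho>/m\<close> sets, and the sum over the layers is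
  harmonic. The total length of the teeth may be infinite, and the logarithm is the price for this.
\<close>

lemma small_cover_ball:
  assumes "0 < \<eta>" "3 * \<eta> \<le> R" "p \<in> S"
  defines "\<rho> \<equiv> R / \<eta>"
  shows "small_cover (path_dist S) (3 * \<eta>) {q \<in> S. path_dist S p q < R} (16 * \<rho> + 4 * \<rho> * ln \<rho>)"
proof -
  define N where "N = nat \<lfloor>\<rho>\<rfloor>"
  define B1 where "B1 = {q \<in> S. fst q = fst p \<and> \<bar>snd q - snd p\<bar> < R}"
  define B2 where "B2 = {q \<in> S. \<bar>fst q - fst p\<bar> < R \<and> \<bar>snd q\<bar> < \<eta>}"
  define B3 where "B3 m = {q \<in> S. \<bar>fst q - fst p\<bar> < R \<and> real m * \<eta> \<le> \<bar>snd q\<bar> \<and> \<bar>snd q\<bar> < (real m + 1) * \<eta>}" for m :: nat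
  have R: "0 < R" using assms by linarith
  have \<rho>: "3 \<le> \<rho>" using assms unfolding \<rho>_def by (simp add: field_simps)
  have N: "1 \<le> N" "real N \<le> \<rho>" using \<rho> unfolding N_def by linarith+
  have wider: "small_cover (path_dist S) (3 * \<eta>) B n" if "small_cover (path_dist S) \<eta> B n" for B n
  proof -
    have "\<eta> \<le> 3 * \<eta>" using assms(1) by simp
    then show ?thesis using that unfolding small_cover_def by (meson less_le_trans)
  qed
  have "small_cover (path_dist S) (3 * \<eta>) (B1 \<union> (B2 \<union> (\<Union>m\<in>{1..N}. B3 m)))
      ((2 * \<rho> + 2) + ((2 * \<rho> + 2) + (\<Sum>m\<in>{1..N}. 4 * \<rho> / m + 4)))"
  proof (intro small_cover_Un small_cover_UN)
    show "small_cover (path_dist S) (3 * \<eta>) B1 (2 * \<rho> + 2)"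
      using wider[OF small_cover_fibre[OF assms(1) R]] by (simp add: B1_def \<rho>_def)
    show "small_cover (path_dist S) (3 * \<eta>) B2 (2 * \<rho> + 2)"
      using small_cover_base[OF assms(1) R] by (simp add: B2_def \<rho>_def)
    show "small_cover (path_dist S) (3 * \<eta>) (B3 m) (4 * \<rho> / m + 4)" if "m \<in> {1..N}" for m
      using wider[OF small_cover_layer[OF assms(1) R, of m]] that by (simp add: B3_def \<rho>_def add.commute)
  qed simp
  moreover have "{q \<in> S. path_dist S p q < R} \<subseteq> B1 \<union> (B2 \<union> (\<Union>m\<in>{1..N}. B3 m))"
  proof
    fix q assume "q \<in> {q \<in> S. path_dist S p q < R}"
    then have q: "q \<in> S" "comb_dist p q < R" using path_dist_eq_comb_dist[OF assms(3), of q] by simp_all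
    show "q \<in> B1 \<union> (B2 \<union> (\<Union>m\<in>{1..N}. B3 m))"
    proof (cases "fst q = fst p")
      case True
      then show ?thesis using q by (simp add: B1_def comb_dist_def abs_minus_commute)
    next
      case False
      then have x: "\<bar>fst q - fst p\<bar> < R" "\<bar>snd q\<bar> < R"
        using q(2) unfolding comb_dist_def by auto
      define m where "m = nat \<lfloor>\<bar>snd q\<bar> / \<eta>\<rfloor>"
      have m: "real m \<le> \<bar>snd q\<bar> / \<eta>" "\<bar>snd q\<bar> / \<eta> < real m + 1"
        using assms(1) unfolding m_def by (simp_all add: of_nat_nat) 
      have "m \<le> N"
        unfolding m_def N_def \<rho>_def using x assms(1) by (intro nat_mono floor_mono divide_right_mono) auto
      moreover have "q \<in> B3 m" using m x q assms(1) unfolding B3_def by (simp add: field_simps)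
      moreover have "q \<in> B2" if "m = 0" using m(2) that x q assms(1) unfolding B2_def by simp
      ultimately show ?thesis by (cases "m = 0") auto
    qed
  qed
  moreover have "(2 * \<rho> + 2) + ((2 * \<rho> + 2) + (\<Sum>m\<in>{1..N}. 4 * \<rho> / m + 4)) \<le> 16 * \<rho> + 4 * \<rho> * ln \<rho>"
  proof -
    have "(\<Sum>m\<in>{1..N}. 4 * \<rho> / m + 4) = 4 * \<rho> * harm N + 4 * N"
      by (simp add: sum.distrib harm_def sum_distrib_left divide_inverse)
    also have "\<dots> \<le> 4 * \<rho> * (1 + ln \<rho>) + 4 * \<rho>"
    proof (intro add_mono mult_left_mono)
      have "harm N \<le> 1 + ln (real N)" by (rule harm_le[OF N(1)])
      also have "\<dots> \<le> 1 + ln \<rho>" using N by simp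
      finally show "harm N \<le> 1 + ln \<rho>" .
    qed (use \<rho> N in simp_all)
    finally show ?thesis using \<rho> by (simp add: algebra_simps)
  qed
  ultimately show ?thesis by (rule small_cover_mono)
qed

text \<open>
  The bound of \<open>small_cover_ball\<close> is of order \<open>\<rho> ln \<rho>\<close> and thus at most \<open>C \<rho>\<^sup>1\<^sup>+\<^sup>e\<close> for every
  \<open>e > 0\<close>.
\<close>

lemma assouad_dim_le: "assouad_dim S (path_dist S) \<le> 1"
proof (rule ennreal_le_epsilon)
  interpret Metric_space S "path_dist S" by (rule Metric_space_path_dist)
  fix e :: real assume "0 < e"
  define C where "C = (16 + 4 / e) * 3 powr (1 + e)"
  have "1 * 1 \<le> C" unfolding C_def using \<open>0 < e\<close> by (intro mult_mono ge_one_powr_ge_zero) auto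
  then have "1 \<le> C" by simp
  have "\<exists>F\<subseteq>S. finite F \<and> real (card F) \<le> C * (R / r) powr (1 + e) \<and> mball p R \<subseteq> (\<Union>y\<in>F. mball y r)"
    if p: "p \<in> S" and r: "0 < r" "r < R" for p r R
  proof -
    define \<rho> where "\<rho> = R / (r / 3)"
    have \<rho>: "1 \<le> \<rho>" "\<rho> = 3 * (R / r)" using r unfolding \<rho>_def by (simp_all add: field_simps)
    have ball: "mball p R = {q \<in> S. path_dist S p q < R}" using p unfolding mball_def by blast
    have "16 * \<rho> + 4 * \<rho> * ln \<rho> \<le> 16 * \<rho> powr (1 + e) + 4 * \<rho> * (\<rho> powr e / e)"
    proof (intro add_mono mult_left_mono)
      show "\<rho> \<le> \<rho> powr (1 + e)" using powr_mono[of 1 "1 + e" \<rho>] \<rho>(1) \<open>0 < e\<close> by simp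
      show "ln \<rho> \<le> \<rho> powr e / e" by (rule ln_powr_bound[OF \<rho>(1) \<open>0 < e\<close>])
    qed (use \<rho> in simp_all)
    also have "\<dots> = (16 + 4 / e) * \<rho> powr (1 + e)"
      using \<rho>(1) by (simp add: powr_add algebra_simps)
    also have "\<dots> = C * (R / r) powr (1 + e)"
      unfolding C_def \<rho>(2) using r by (subst powr_mult) simp_all
    finally have bound: "16 * \<rho> + 4 * \<rho> * ln \<rho> \<le> C * (R / r) powr (1 + e)" .
    have "small_cover (path_dist S) (3 * (r / 3)) (mball p R) (16 * \<rho> + 4 * \<rho> * ln \<rho>)"
      unfolding ball \<rho>_def by (rule small_cover_ball) (use r p in simp_all)
    then have "small_cover (path_dist S) r (mball p R) (C * (R / r) powr (1 + e))"
      using small_cover_mono[OF _ order_refl bound] by simp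
    then show ?thesis by (rule small_cover_balls) auto
  qed
  then have "assouad_dim S (path_dist S) \<le> ennreal (1 + e)"
    unfolding assouad_dim_def using \<open>1 \<le> C\<close> \<open>0 < e\<close>
    by (intro Inf_lower CollectI exI[of _ "1 + e"] conjI exI[of _ C] ballI allI impI refl; (elim conjE)?; simp)
  also have "\<dots> = 1 + ennreal e" using \<open>0 < e\<close> by (subst ennreal_plus) simp_all
  finally show "assouad_dim S (path_dist S) \<le> 1 + ennreal e" .
qed

lemma hausdorff_le_assouad: "hausdorff_dim S (path_dist S) \<le> assouad_dim S (path_dist S)"
proof (rule hausdorff_dim_le_assouad_dim[OF Metric_space_path_dist])
  show o: "(0, 0) \<in> S" using base by simp
  fix q assume "q \<in> S"
  then have "\<bar>fst q\<bar> \<le> 1" "\<bar>snd q\<bar> \<le> 1"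
    using over_base[of "fst q" "snd q"] height[of "fst q" "snd q"] by auto
  then have "comb_dist (0, 0) q < 3" by (simp add: comb_dist_def)
  then show "path_dist S (0, 0) q < 3" using o \<open>q \<in> S\<close> by (simp add: path_dist_eq_comb_dist)
qed

theorem hausdorff_dim_eq: "hausdorff_dim S (path_dist S) = 1"
  and assouad_dim_eq: "assouad_dim S (path_dist S) = 1"
  using hausdorff_dim_ge hausdorff_le_assouad assouad_dim_le by (meson order.antisym order.trans)+


text \<open>
  The comb is cut at height \<open>2s\<close>. The part near the base is cut into pieces over cells of length
  \<open>2s\<close>, the rest of each tooth into pieces of length \<open>2s\<close>. A set of diameter at most \<open>s\<close> that
  contains a point above the cut stays on that tooth and meets at most two neighbouring pieces
  there, where the bottom piece is the one near the base; a set below the cut meets at most two pieces,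
  since its projection to the base has diameter at most \<open>s\<close>.
\<close>

lemma nagata_cover:
  assumes "0 < s"
  shows "\<exists>\<B>. \<Union>\<B> = S \<and> (\<forall>B\<in>\<B>. ediam (path_dist S) B \<le> ennreal (6 * s)) \<and>
    (\<forall>A\<subseteq>S. ediam (path_dist S) A \<le> ennreal s \<longrightarrow>
      finite {B\<in>\<B>. A \<inter> B \<noteq> {}} \<and> card {B\<in>\<B>. A \<inter> B \<noteq> {}} \<le> 1 + 1)"
proof -
  define lab :: "real \<times> real \<Rightarrow> (real \<times> bool) option \<times> int" where
    "lab q = (if \<bar>snd q\<bar> < 2 * s then (None, \<lfloor>fst q / (2 * s)\<rfloor>)
              else (Some (fst q, 0 \<le> snd q), \<lfloor>\<bar>snd q\<bar> / (2 * s)\<rfloor>))" for q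
  have s2: "0 < 2 * s" using assms by simp
  have lab_eq: "comb_dist p q \<le> 6 * s" if eq: "lab p = lab q" for p q
  proof (cases "\<bar>snd p\<bar> < 2 * s")
    case True
    then have q: "\<bar>snd q\<bar> < 2 * s" "\<lfloor>fst p / (2 * s)\<rfloor> = \<lfloor>fst q / (2 * s)\<rfloor>"
      using eq by (auto simp: lab_def split: if_splits)
    have "\<bar>fst p - fst q\<bar> < 2 * s" by (rule floor_eq_imp_close[OF q(2) s2])
    then show ?thesis using True q(1) unfolding comb_dist_def by auto
  next
    case False
    then have q: "\<not> \<bar>snd q\<bar> < 2 * s" "fst p = fst q" "0 \<le> snd p \<longleftrightarrow> 0 \<le> snd q"
      "\<lfloor>\<bar>snd p\<bar> / (2 * s)\<rfloor> = \<lfloor>\<bar>snd q\<bar> / (2 * s)\<rfloor>"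
      using eq by (auto simp: lab_def split: if_splits)
    have "\<bar>\<bar>snd p\<bar> - \<bar>snd q\<bar>\<bar> < 2 * s" by (rule floor_eq_imp_close[OF q(4) s2])
    then have "\<bar>snd p - snd q\<bar> < 2 * s" using q(3) by linarith
    then show ?thesis using q(2) assms unfolding comb_dist_def by simp
  qed
  have two: "\<exists>l l'. lab ` A \<subseteq> {l, l'}"
    if close: "\<And>p q. p \<in> A \<Longrightarrow> q \<in> A \<Longrightarrow> comb_dist p q \<le> s" for A
  proof (cases "\<forall>p\<in>A. \<bar>snd p\<bar> < 2 * s")
    case True
    have "\<bar>fst p - fst q\<bar> \<le> s" if "p \<in> A" "q \<in> A" for p q
      using close[OF that] abs_fst_le_comb_dist[of p q] by linarith
    then obtain m where "\<forall>q\<in>A. \<lfloor>fst q / (2 * s)\<rfloor> \<in> {m, m + 1}"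
      using floor_two_values[OF assms, of A fst] by blast
    then have "lab ` A \<subseteq> {(None, m), (None, m + 1)}" using True by (auto simp: lab_def)
    then show ?thesis by blast
  next
    case False
    then obtain p where p: "p \<in> A" "2 * s \<le> \<bar>snd p\<bar>" by force
    have fib: "fst q = fst p" if "q \<in> A" for q
    proof (rule ccontr)
      assume "fst q \<noteq> fst p"
      then have "\<bar>snd p\<bar> \<le> comb_dist p q" unfolding comb_dist_def by simp
      then show False using close[OF p(1) that] p(2) assms by linarith
    qed
    have diff: "\<bar>snd q - snd q'\<bar> \<le> s" if "q \<in> A" "q' \<in> A" for q q'
      using close[OF that] fib that unfolding comb_dist_def by simp
    have "\<bar>\<bar>snd q\<bar> - \<bar>snd q'\<bar>\<bar> \<le> s" if "q \<in> A" "q' \<in> A" for q q'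
      using diff[OF that] by linarith
    then obtain m where m: "\<forall>q\<in>A. \<lfloor>\<bar>snd q\<bar> / (2 * s)\<rfloor> \<in> {m, m + 1}"
      using floor_two_values[OF assms, of A "\<lambda>q. \<bar>snd q\<bar>"] by blast
    \<comment> \<open>On one tooth, the label is determined by the number of the piece; number \<open>0\<close> is the piece near the base.\<close>
    define L where "L n = (if n = 0 then (None, \<lfloor>fst p / (2 * s)\<rfloor>) else (Some (fst p, 0 \<le> snd p), n))" for n :: int
    have "lab q = L \<lfloor>\<bar>snd q\<bar> / (2 * s)\<rfloor>" if q: "q \<in> A" for q
    proof (cases "\<bar>snd q\<bar> < 2 * s")
      case True
      then have "\<lfloor>\<bar>snd q\<bar> / (2 * s)\<rfloor> = 0" using assms by (simp add: floor_eq_iff)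
      then show ?thesis using True fib[OF q] by (simp add: lab_def L_def)
    next
      case False
      then have "1 \<le> \<bar>snd q\<bar> / (2 * s)" using assms by simp
      then have "\<lfloor>\<bar>snd q\<bar> / (2 * s)\<rfloor> \<noteq> 0" by linarith
      moreover have "0 \<le> snd q \<longleftrightarrow> 0 \<le> snd p" using diff[OF p(1) q] p(2) False assms by linarith
      ultimately show ?thesis using False fib[OF q] by (simp add: lab_def L_def)
    qed
    then have "lab ` A \<subseteq> {L m, L (m + 1)}" using m by auto
    then show ?thesis by blast
  qed
  define fib where "fib l = {q \<in> S. lab q = l}" for l
  show ?thesis
  proof (intro exI[of _ "range fib"] conjI ballI allI impI)
    show "\<Union> (range fib) = S" unfolding fib_def by blast
    show "ediam (path_dist S) B \<le> ennreal (6 * s)" if B: "B \<in> range fib" for B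
    proof -
      have "path_dist S p q \<le> 6 * s" if "p \<in> B" "q \<in> B" for p q
      proof -
        have "p \<in> S" "q \<in> S" "lab p = lab q" using that B unfolding fib_def by auto
        then show ?thesis using lab_eq by (simp add: path_dist_eq_comb_dist)
      qed
      then show ?thesis using assms by (simp add: ediam_le_iff)
    qed
    fix A assume A: "A \<subseteq> S" "ediam (path_dist S) A \<le> ennreal s"
    have "comb_dist p q \<le> s" if "p \<in> A" "q \<in> A" for p q
    proof -
      have "path_dist S p q \<le> s" using A(2) that assms by (simp add: ediam_le_iff)
      moreover have "p \<in> S" "q \<in> S" using A(1) that by blast+
      ultimately show ?thesis by (simp add: path_dist_eq_comb_dist)
    qed
    then obtain l l' where l: "lab ` A \<subseteq> {l, l'}" using two by blast
    have sub: "{B \<in> range fib. A \<inter> B \<noteq> {}} \<subseteq> {fib l, fib l'}"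
    proof
      fix B assume "B \<in> {B \<in> range fib. A \<inter> B \<noteq> {}}"
      then obtain k q where "B = fib k" "q \<in> A" "q \<in> fib k" by blast
      then show "B \<in> {fib l, fib l'}" using l unfolding fib_def by auto
    qed
    show "finite {B \<in> range fib. A \<inter> B \<noteq> {}}" by (rule finite_subset[OF sub]) simp
    have "card {B \<in> range fib. A \<inter> B \<noteq> {}} \<le> card {fib l, fib l'}" by (rule card_mono[OF _ sub]) simp
    also have "\<dots> \<le> 1 + 1" by (simp add: card_insert_if)
    finally show "card {B \<in> range fib. A \<inter> B \<noteq> {}} \<le> 1 + 1" .
  qed
qed

text \<open>
  If every set of diameter at most \<open>s\<close> meets only one member, a chain of points of the base in
  steps shorter than \<open>s\<close> cannot leave the member in which it starts. For covers by sets of diameter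
  less than \<open>1\<close> this excludes Nagata dimension \<open>0\<close>.
\<close>

lemma base_in_one_member:
  assumes "0 < s" and \<B>: "\<Union>\<B> = S"
    and one: "\<And>A. A \<subseteq> S \<Longrightarrow> ediam (path_dist S) A \<le> ennreal s \<Longrightarrow>
      finite {B\<in>\<B>. A \<inter> B \<noteq> {}} \<and> card {B\<in>\<B>. A \<inter> B \<noteq> {}} \<le> 1"
  shows "\<exists>B\<in>\<B>. (0, 0) \<in> B \<and> (1, 0) \<in> B"
proof -
  obtain n :: nat where n: "0 < n" "1 / n < s"
    using reals_Archimedean[OF \<open>0 < s\<close>] by (metis inverse_eq_divide zero_less_Suc)
  define p where "p i = (real i / n, 0::real)" for i :: nat
  have pS: "p i \<in> S" if "i \<le> n" for i
    unfolding p_def by (rule base) (use that n in simp)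
  obtain B where B: "B \<in> \<B>" "p 0 \<in> B" using pS[of 0] \<B> by blast
  have "p i \<in> B" if "i \<le> n" for i
    using that
  proof (induction i)
    case 0 then show ?case using B by simp
  next
    case (Suc i)
    let ?A = "{p i, p (Suc i)}"
    have A: "?A \<subseteq> S" using pS Suc.prems by simp
    have step: "comb_dist (p i) (p (Suc i)) \<le> s" "comb_dist (p (Suc i)) (p i) \<le> s"
      using n by (simp_all add: comb_dist_def p_def abs_if field_simps)
    have "comb_dist x x = 0" for x by (simp add: comb_dist_def)
    then have "ediam (path_dist S) ?A \<le> ennreal s"
      using A step \<open>0 < s\<close> by (simp add: ediam_le_iff path_dist_eq_comb_dist)
    then have c: "finite {B\<in>\<B>. ?A \<inter> B \<noteq> {}}" "card {B\<in>\<B>. ?A \<inter> B \<noteq> {}} \<le> 1"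
      using one[OF A] by blast+
    obtain B' where B': "B' \<in> \<B>" "p (Suc i) \<in> B'" using A \<B> by blast
    have "p i \<in> B" using Suc by simp
    then have "B \<in> {B\<in>\<B>. ?A \<inter> B \<noteq> {}}" "B' \<in> {B\<in>\<B>. ?A \<inter> B \<noteq> {}}" using B B' by auto
    then have "B = B'" using c card_le_Suc0_iff_eq[OF c(1)] by simp
    then show ?case using B' by simp
  qed
  then have "p n \<in> B" by simp
  then show ?thesis using B n by (intro bexI[of _ B]) (simp_all add: p_def)
qed

theorem nagata_dim_eq: "nagata_dim S (path_dist S) = 1"
proof (rule antisym)
  have "\<exists>\<kappa>>0. \<forall>s>0. \<exists>\<B>. \<Union>\<B> = S \<and> (\<forall>B\<in>\<B>. ediam (path_dist S) B \<le> ennreal (\<kappa> * s)) \<and>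
      (\<forall>A\<subseteq>S. ediam (path_dist S) A \<le> ennreal s \<longrightarrow>
        finite {B\<in>\<B>. A \<inter> B \<noteq> {}} \<and> card {B\<in>\<B>. A \<inter> B \<noteq> {}} \<le> 1 + 1)"
    using nagata_cover by (intro exI[of _ 6]) simp
  then show "nagata_dim S (path_dist S) \<le> 1"
    unfolding nagata_dim_def one_enat_def by (intro Inf_lower) blast
  show "1 \<le> nagata_dim S (path_dist S)"
    unfolding nagata_dim_def
  proof (rule Inf_greatest, clarify)
    fix m :: nat and \<kappa> :: real
    assume \<kappa>: "0 < \<kappa>" and cover: "\<forall>s>0. \<exists>\<B>. \<Union>\<B> = S \<and> (\<forall>B\<in>\<B>. ediam (path_dist S) B \<le> ennreal (\<kappa> * s)) \<and>
      (\<forall>A\<subseteq>S. ediam (path_dist S) A \<le> ennreal s \<longrightarrow>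
        finite {B\<in>\<B>. A \<inter> B \<noteq> {}} \<and> card {B\<in>\<B>. A \<inter> B \<noteq> {}} \<le> m + 1)"
    show "1 \<le> enat m"
    proof (rule ccontr)
      assume "\<not> 1 \<le> enat m"
      then have "m = 0" by (simp add: one_enat_def)
      \<comment> \<open>Any \<open>s\<close> with \<open>\<kappa> s < 1\<close> would do, since the endpoints of the base have distance \<open>1\<close>.\<close>
      define s where "s = 1 / (2 * \<kappa>)"
      have s: "0 < s" "\<kappa> * s < 1" using \<kappa> unfolding s_def by simp_all
      obtain \<B> where \<B>: "\<Union>\<B> = S" "\<forall>B\<in>\<B>. ediam (path_dist S) B \<le> ennreal (\<kappa> * s)"
        "\<forall>A\<subseteq>S. ediam (path_dist S) A \<le> ennreal s \<longrightarrow>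
          finite {B\<in>\<B>. A \<inter> B \<noteq> {}} \<and> card {B\<in>\<B>. A \<inter> B \<noteq> {}} \<le> m + 1"
        using cover s(1) by meson
      obtain B where B: "B \<in> \<B>" "(0, 0) \<in> B" "(1, 0) \<in> B"
        using base_in_one_member[OF s(1) \<B>(1)] \<B>(3) \<open>m = 0\<close> by auto
      have "ediam (path_dist S) B \<le> ennreal (\<kappa> * s)" using \<B>(2) B(1) by blast
      then have "path_dist S (0, 0) (1, 0) \<le> \<kappa> * s" using B s \<kappa> by (simp add: ediam_le_iff)
      moreover have "path_dist S (0, 0) (1, 0) = 1"
        using base by (subst path_dist_eq_comb_dist) (simp_all add: comb_dist_def)
      ultimately show False using s(2) by simp
    qed
  qed
qed

end

section \<open>The trees are combs\<close>

definition breakpoints :: "real \<Rightarrow> nat \<Rightarrow> real set" where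
  "breakpoints a k = (\<Union>(l, w)\<in>distinguished a k. {l, l + w})"

lemma distinguished_Suc_cases:
  assumes "(l, w) \<in> distinguished a (Suc k)"
  obtains l' w' where "(l', w') \<in> distinguished a k"
    "(l, w) = (l', a * w') \<or> (l, w) = (l' + a * w', (1 - 2 * a) * w') \<or> (l, w) = (l' + (1 - a) * w', a * w')"
  using assms by auto

lemma distinguished_SucI:
  assumes "(l, w) \<in> distinguished a k"
  shows "(l, a * w) \<in> distinguished a (Suc k)"
    "(l + a * w, (1 - 2 * a) * w) \<in> distinguished a (Suc k)"
    "(l + (1 - a) * w, a * w) \<in> distinguished a (Suc k)"
  using assms by force+

context
  fixes a :: real
  assumes a: "0 < a" "a \<le> 1/3"
begin

lemma distinguished_bounds:
  "(l, w) \<in> distinguished a k \<Longrightarrow> 0 < w \<and> 0 \<le> l \<and> l + w \<le> 1"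
proof (induction k arbitrary: l w)
  case (Suc k)
  from Suc.prems obtain l' w' where p: "(l', w') \<in> distinguished a k"
    "(l, w) = (l', a * w') \<or> (l, w) = (l' + a * w', (1 - 2 * a) * w') \<or> (l, w) = (l' + (1 - a) * w', a * w')"
    by (rule distinguished_Suc_cases)
  have b: "0 < w'" "0 \<le> l'" "l' + w' \<le> 1" using Suc.IH[OF p(1)] by auto
  have "0 < a * w'" "0 < (1 - 2 * a) * w'" using a b by simp_all
  then have aw: "0 < a * w'" "0 < w' - 2 * (a * w')" by (simp_all add: algebra_simps)
  have "l = l' \<and> w = a * w' \<or> l = l' + a * w' \<and> w = w' - 2 * (a * w') \<or> l = l' + w' - a * w' \<and> w = a * w'"
    using p(2) by (simp add: algebra_simps)
  then show ?case using aw b by (elim disjE conjE; intro conjI; linarith)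
qed auto

text \<open>
  In the induction step, both \<open>b\<close> and the given interval stem from intervals of the previous
  stage. By the induction hypothesis, these two are equal or have disjoint interiors, because
  no endpoint of one lies in the interior of the other.
\<close>

lemma breakpoints_avoid:
  "(l, w) \<in> distinguished a k \<Longrightarrow> b \<in> breakpoints a k \<Longrightarrow> b \<le> l \<or> l + w \<le> b"
proof (induction k arbitrary: l w b)
  case 0
  then show ?case by (auto simp: breakpoints_def)
next
  case (Suc k)
  from Suc.prems(1) obtain l' w' where p: "(l', w') \<in> distinguished a k"
    "(l, w) = (l', a * w') \<or> (l, w) = (l' + a * w', (1 - 2 * a) * w') \<or> (l, w) = (l' + (1 - a) * w', a * w')"
    by (rule distinguished_Suc_cases)
  from Suc.prems(2) obtain u v where uv: "(u, v) \<in> distinguished a (Suc k)" "b = u \<or> b = u + v"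
    unfolding breakpoints_def by blast
  from uv(1) obtain u' v' where q: "(u', v') \<in> distinguished a k"
    "(u, v) = (u', a * v') \<or> (u, v) = (u' + a * v', (1 - 2 * a) * v') \<or> (u, v) = (u' + (1 - a) * v', a * v')"
    by (rule distinguished_Suc_cases)
  have pos: "0 < w'" "0 < v'" using distinguished_bounds p(1) q(1) by blast+
  have aw: "0 < a * w'" "0 < a * v'" "0 < (1 - 2 * a) * w'" "0 < (1 - 2 * a) * v'" using a pos by simp_all
  have pos_mid: "0 < w' - 2 * (a * w')" "0 < v' - 2 * (a * v')"
    using aw(3,4) by (simp_all add: algebra_simps)
  have cases_lw: "l = l' \<and> w = a * w' \<or> l = l' + a * w' \<and> w = w' - 2 * (a * w') \<or> l = l' + w' - a * w' \<and> w = a * w'"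
    using p(2) by (simp add: algebra_simps)
  then have lw: "l' \<le> l \<and> l + w \<le> l' + w'"
    using aw(1) pos_mid(1) by (elim disjE conjE; intro conjI; linarith)
  have b: "b = u' \<or> b = u' + a * v' \<or> b = u' + v' - a * v' \<or> b = u' + v'"
    using uv(2) q(2) by (auto simp: algebra_simps)
  have mem: "u' \<in> breakpoints a k" "u' + v' \<in> breakpoints a k" "l' \<in> breakpoints a k" "l' + w' \<in> breakpoints a k"
    using p(1) q(1) unfolding breakpoints_def by auto
  have avoid: "u' \<le> l' \<or> l' + w' \<le> u'" "u' + v' \<le> l' \<or> l' + w' \<le> u' + v'"
    "l' \<le> u' \<or> u' + v' \<le> l'" "l' + w' \<le> u' \<or> u' + v' \<le> l' + w'"
    using Suc.IH[OF p(1)] Suc.IH[OF q(1)] mem by blast+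
  have bb: "u' \<le> b \<and> b \<le> u' + v'"
    using b aw(2) pos_mid(2) by (elim disjE; intro conjI; linarith)
  show ?case
  proof (cases "u' = l' \<and> v' = w'")
    case True
    then have "b = l' \<or> b = l' + a * w' \<or> b = l' + w' - a * w' \<or> b = l' + w'" using b by simp
    then show ?thesis using cases_lw aw(1) pos_mid(1) by (elim disjE conjE; linarith)
  next
    case False
    then have "u' + v' \<le> l' \<or> l' + w' \<le> u'" using avoid pos by linarith
    then show ?thesis using bb lw by linarith
  qed
qed

lemma breakpoints_mono: "m \<le> n \<Longrightarrow> breakpoints a m \<subseteq> breakpoints a n"
proof (induction n rule: dec_induct)
  case (step n)
  have "breakpoints a n \<subseteq> breakpoints a (Suc n)"
  proof
    fix b assume "b \<in> breakpoints a n"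
    then obtain l w where lw: "(l, w) \<in> distinguished a n" "b = l \<or> b = l + w"
      unfolding breakpoints_def by blast
    have "l \<in> breakpoints a (Suc n)" "l + (1 - a) * w + a * w \<in> breakpoints a (Suc n)"
      using distinguished_SucI(1,3)[OF lw(1)] unfolding breakpoints_def by blast+
    then show "b \<in> breakpoints a (Suc n)" using lw(2) by (auto simp: algebra_simps)
  qed
  then show ?case using step by blast
qed simp

text \<open>
  A new subdivision point of an interval of length \<open>w\<close> has pieces of lengths \<open>aw\<close> and
  \<open>(1 - 2a)w \<ge> aw\<close> next to it, because \<open>a \<le> 1/3\<close>. Other breakpoints of the same stage do not lie in the
  interiors of these pieces.
\<close>

lemma subdivision_point_isolated:
  assumes lw: "(l, w) \<in> distinguished a k" and x: "x \<in> {l + a * w, l + (1 - a) * w}"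
  shows "x \<in> breakpoints a (Suc k)"
    and "x' \<in> breakpoints a (Suc k) \<Longrightarrow> x' \<noteq> x \<Longrightarrow> a * w \<le> \<bar>x - x'\<bar>"
proof -
  note sub = distinguished_SucI[OF lw]
  have w: "0 < w" using distinguished_bounds[OF lw] by simp
  show "x \<in> breakpoints a (Suc k)" using x sub(2,3) unfolding breakpoints_def by blast
  assume x': "x' \<in> breakpoints a (Suc k)" "x' \<noteq> x"
  have "a * w \<le> (1 - 2 * a) * w" using a w by (intro mult_right_mono) simp_all
  then show "a * w \<le> \<bar>x - x'\<bar>"
    using x x'(2) breakpoints_avoid[OF sub(1) x'(1)] breakpoints_avoid[OF sub(2) x'(1)]
      breakpoints_avoid[OF sub(3) x'(1)]
    by (auto simp: algebra_simps)
qed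

end

lemma mem_vertical_segment:
  "(x, h) \<in> closed_segment (u, 0) (u, v) \<longleftrightarrow> x = u \<and> h \<in> closed_segment 0 v" for x :: real
  by (auto simp: closed_segment_def algebra_simps)

lemma mem_unit_segment:
  "(x, h) \<in> closed_segment (0, 0) (1, 0) \<longleftrightarrow> h = 0 \<and> x \<in> {0..1}" for x h :: real
  by (auto simp: closed_segment_def)

lemma mem_tree_iff:
  "(x, h) \<in> tree c a \<longleftrightarrow>
     h = 0 \<and> x \<in> {0..1} \<or>
     x \<in> {0, 1} \<and> h \<in> closed_segment 0 c \<union> closed_segment 0 (- c) \<or>
     (\<exists>k l w. (l, w) \<in> distinguished a k \<and> x \<in> {l + a * w, l + (1 - a) * w} \<and>
       h \<in> closed_segment 0 (c * a * w))"
proof -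
  have "(x, h) \<in> tree_stage c a n \<longleftrightarrow>
     h = 0 \<and> x \<in> {0..1} \<or>
     x \<in> {0, 1} \<and> h \<in> closed_segment 0 c \<union> closed_segment 0 (- c) \<or>
     (\<exists>k<n. \<exists>l w. (l, w) \<in> distinguished a k \<and> x \<in> {l + a * w, l + (1 - a) * w} \<and>
       h \<in> closed_segment 0 (c * a * w))" (is "_ = ?R n") for n
  proof (induction n)
    case 0
    show ?case by (auto simp: mem_vertical_segment mem_unit_segment)
  next
    case (Suc n)
    have "?R (Suc n) \<longleftrightarrow> ?R n \<or> (\<exists>l w. (l, w) \<in> distinguished a n \<and>
        x \<in> {l + a * w, l + (1 - a) * w} \<and> h \<in> closed_segment 0 (c * a * w))"
      unfolding less_Suc_eq by blast
    then show ?case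
      unfolding tree_stage.simps Un_iff Suc.IH UN_iff Bex_def split_paired_Ex case_prod_conv mem_vertical_segment
      by blast
  qed
  then show ?thesis unfolding tree_def by blast
qed

text \<open>
  The gap condition: a tooth of length \<open>c a w \<le> a w\<close> stands at a distance of at least \<open>a w\<close> from all
  breakpoints of its stage, and the two teeth at the ends of the base have length \<open>c \<le> 1\<close>. Of two
  teeth, one has the later stage; then the other one stands at a breakpoint of that stage too.
\<close>

lemma tree_is_comb:
  assumes c: "0 < c" "c < 1" and a: "0 < a" "a \<le> 1/3"
  shows "comb (tree c a)"
proof
  fix x :: real assume "x \<in> {0..1}" then show "(x, 0) \<in> tree c a" by (simp add: mem_tree_iff)
next
  fix x h assume xh: "(x, h) \<in> tree c a"
  have lw: "x \<in> {0..1} \<and> c * a * w \<le> 1"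
    if "(l, w) \<in> distinguished a k" "x \<in> {l + a * w, l + (1 - a) * w}" for l w k
  proof -
    have b: "0 < w" "0 \<le> l" "l + w \<le> 1" using distinguished_bounds[OF a that(1)] by auto
    have "0 \<le> a * w" "a * w \<le> 1 * w" using a b by (simp_all add: mult_right_mono)
    moreover have "a * w \<le> 1" using calculation b by linarith
    moreover have "c * (a * w) \<le> 1 * 1" using c calculation by (intro mult_mono) simp_all
    moreover have "x = l + a * w \<or> x = l + w - a * w" using that(2) by (simp add: algebra_simps)
    ultimately have "0 \<le> x \<and> x \<le> 1 \<and> c * (a * w) \<le> 1" using b by linarith
    then show ?thesis by (simp add: mult.assoc)
  qed
  have pos: "0 \<le> c * a * w" if "(l, w) \<in> distinguished a k" for l w k
    using distinguished_bounds[OF a that] a c by simp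
  show "x \<in> {0..1}"
    using xh lw unfolding mem_tree_iff by fastforce
  show "\<bar>h\<bar> \<le> 1"
  proof -
    have "\<bar>h\<bar> \<le> \<bar>v\<bar>" if "h \<in> closed_segment 0 v" for v
      using that by (auto simp: closed_segment_eq_real_ivl split: if_splits)
    then show ?thesis using xh lw pos c unfolding mem_tree_iff by fastforce
  qed
  fix u assume u: "u \<in> closed_segment 0 h"
  have "u \<in> closed_segment 0 v" if "h \<in> closed_segment 0 v" for v
    using u that closed_segment_subset[OF _ that] convex_closed_segment ends_in_segment by blast
  moreover have "u = 0" if "h = 0" using u that by simp
  ultimately show "(x, u) \<in> tree c a"
    using xh unfolding mem_tree_iff by blast
next
  have isolated: "\<exists>n. x \<in> breakpoints a n \<and> (\<forall>x'\<in>breakpoints a n. x' \<noteq> x \<longrightarrow> \<bar>h\<bar> \<le> \<bar>x - x'\<bar>)"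
    if xh: "(x, h) \<in> tree c a" "h \<noteq> 0" for x h
  proof -
    consider "x \<in> {0, 1}" "h \<in> closed_segment 0 c \<union> closed_segment 0 (- c)"
      | k l w where "(l, w) \<in> distinguished a k" "x \<in> {l + a * w, l + (1 - a) * w}" "h \<in> closed_segment 0 (c * a * w)"
      using xh unfolding mem_tree_iff by blast
    then show ?thesis
    proof cases
      case 1
      then have "\<bar>h\<bar> \<le> 1" using c by (auto simp: closed_segment_eq_real_ivl)
      then show ?thesis using 1(1) by (intro exI[of _ 0]) (auto simp: breakpoints_def)
    next
      case (2 k l w)
      have "0 < a * w" using distinguished_bounds[OF a 2(1)] a by simp
      then have "\<bar>h\<bar> \<le> a * w"
        using 2(3) c mult_left_le_one_le[of "a * w" c] by (auto simp: closed_segment_eq_real_ivl mult.assoc)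
      then show ?thesis
        using subdivision_point_isolated[OF a 2(1,2)] by (intro exI[of _ "Suc k"]) (auto intro: order_trans)
    qed
  qed
  fix x h x' h' assume xh: "(x, h) \<in> tree c a" "(x', h') \<in> tree c a" "x \<noteq> x'"
  show "min \<bar>h\<bar> \<bar>h'\<bar> \<le> \<bar>x - x'\<bar>"
  proof (cases "h = 0 \<or> h' = 0")
    case False
    obtain n where n: "x \<in> breakpoints a n" "\<And>y. y \<in> breakpoints a n \<Longrightarrow> y \<noteq> x \<Longrightarrow> \<bar>h\<bar> \<le> \<bar>x - y\<bar>"
      using isolated[OF xh(1)] False by blast
    obtain n' where n': "x' \<in> breakpoints a n'" "\<And>y. y \<in> breakpoints a n' \<Longrightarrow> y \<noteq> x' \<Longrightarrow> \<bar>h'\<bar> \<le> \<bar>x' - y\<bar>"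
      using isolated[OF xh(2)] False by blast
    show ?thesis
    proof (cases "n \<le> n'")
      case True
      then have "\<bar>h'\<bar> \<le> \<bar>x' - x\<bar>" using n'(2)[of x] n(1) breakpoints_mono[OF a True] xh(3) by blast
      then show ?thesis by linarith
    next
      case False
      then have "\<bar>h\<bar> \<le> \<bar>x - x'\<bar>" using n(2)[of x'] n'(1) breakpoints_mono[OF a, of n' n] xh(3) by fastforce
      then show ?thesis by linarith
    qed
  qed auto
qed

theorem proposition4p2:
  fixes c a :: real
  assumes "0 < c" and "c < 1" and "1/4 \<le> a" and "a \<le> 1/3"
  shows "(\<exists>f :: real \<times> real \<Rightarrow> real ^ 2. bilipschitz_embedding (tree c a) (tree_dist c a) f) \<and>
         hausdorff_dim (tree c a) (tree_dist c a) = 1 \<and>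
         nagata_dim (tree c a) (tree_dist c a) = 1 \<and>
         assouad_dim (tree c a) (tree_dist c a) = 1"
proof -
  interpret comb "tree c a" using tree_is_comb assms by simp
  show ?thesis
    unfolding tree_dist_def
    using bilipschitz_in_plane hausdorff_dim_eq nagata_dim_eq assouad_dim_eq by blast
qed

end
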